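(* For every $n\ge 1$, the Snort position on the empty path with $n$ vertices has temperature at most $7\tfrac12$.
   Context: Snort is played on a graph under normal play (the player unable to move loses): the players Left and Right alternately place a piece of their own colour on an empty vertex that is not adjacent to any vertex containing a piece of the opponent. Temperature: for a short game, with stops $LS,RS$ (for a number $x$, $LS=RS=x$; otherwise $LS(G)=\max_{G^L}RS(G^L)$, $RS(G)=\min_{G^R}LS(G^R)$), an infinitesimal is a game with both stops $0$, and $G,H$ are infinitesimally close if $G-H$ is infinitesimal; cooling $G_t$ ($t\ge-1$): $G_t=n$ if $G$ is an integer $n$, otherwise with $\tilde G_t=\{G^{\mathcal L}_t-t\mid G^{\mathcal R}_t+t\}$, $G_t=\tilde G_t$ unless some $s<t$ has $\tilde G_s$ infinitesimally close to a number, in which case $G_t$ is the number $x$ to which $\tilde G_s$ is infinitesimally close for the smallest such $s$. The temperature $t(G)$ is the smallest $t\ge -1$ with $G_t$ infinitesimally close to a number. *)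

theory Defs
  imports Complex_Main "HOL-Library.FSet"
begin

section \<open>Short games\<close>

text \<open>Elements of \<open>game\<close> are game forms; equality of game values is \<open>\<approx>\<close> below, not \<open>=\<close>.\<close>

datatype game = Game (lopts: "game fset") (ropts: "game fset")

lemma size_lopts: "x |\<in>| lopts G \<Longrightarrow> size x < size G"
  and size_ropts: "x |\<in>| ropts G \<Longrightarrow> size x < size G"
proof -
  have *: "size x \<le> (\<Sum>y\<in>fset A. Suc (size y))" if "x |\<in>| A" for A :: "game fset"
    using member_le_sum[of x "fset A" "\<lambda>y. Suc (size y)"] that by simp
  show "x |\<in>| lopts G \<Longrightarrow> size x < size G"
    using *[of "lopts G"] by (cases G) simp
  show "x |\<in>| ropts G \<Longrightarrow> size x < size G"
    using *[of "ropts G"] by (cases G) simp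
qed

function game_add :: "game \<Rightarrow> game \<Rightarrow> game" where
  "game_add G H = Game
     ((\<lambda>G'. game_add G' H) |`| lopts G |\<union>| (\<lambda>H'. game_add G H') |`| lopts H)
     ((\<lambda>G'. game_add G' H) |`| ropts G |\<union>| (\<lambda>H'. game_add G H') |`| ropts H)"
  by pat_completeness auto
termination
  by (relation "measure (\<lambda>(G, H). size G + size H)") (auto dest: size_lopts size_ropts)

declare game_add.simps [simp del]

primrec game_neg :: "game \<Rightarrow> game" where
  "game_neg (Game Ls Rs) = Game (game_neg |`| Rs) (game_neg |`| Ls)"

text \<open>\<open>G \<le> H\<close> iff Right, moving second, wins \<open>G - H\<close> under normal play.\<close>

function game_le :: "game \<Rightarrow> game \<Rightarrow> bool" where
  "game_le G H \<longleftrightarrow>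
     (\<forall>G'. G' |\<in>| lopts G \<longrightarrow> \<not> game_le H G') \<and> (\<forall>H'. H' |\<in>| ropts H \<longrightarrow> \<not> game_le H' G)"
  by pat_completeness auto
termination
  by (relation "measure (\<lambda>(G, H). size G + size H)") (auto dest: size_lopts size_ropts)

declare game_le.simps [simp del]

instantiation game :: "{zero, plus, uminus, minus, ord}"
begin

definition "0 = Game {||} {||}"
definition "G + H = game_add G H"
definition "- G = game_neg G"
definition "G - H = G + - H" for G H :: game
definition "G \<le> H \<longleftrightarrow> game_le G H"
definition "G < H \<longleftrightarrow> G \<le> H \<and> \<not> H \<le> G" for G H :: game

instance ..

end

definition game_eq :: "game \<Rightarrow> game \<Rightarrow> bool" (infix "\<approx>" 50) where
  "G \<approx> H \<longleftrightarrow> G \<le> H \<and> H \<le> G"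


section \<open>Numbers\<close>

text \<open>The short games that are numbers are the dyadic rationals.\<close>

definition dyadics :: "real set" where
  "dyadics = {of_int m / 2 ^ k | (m :: int) (k :: nat). True}"

primrec nat_game :: "nat \<Rightarrow> game" where
  "nat_game 0 = 0"
| "nat_game (Suc n) = Game {|nat_game n|} {||}"

definition int_game :: "int \<Rightarrow> game" where
  "int_game n = (if 0 \<le> n then nat_game (nat n) else - nat_game (nat (- n)))"

text \<open>\<open>dyadic_game m k\<close> is the canonical form of \<open>m / 2 ^ k\<close>, which for odd \<open>m\<close> and \<open>k > 0\<close>
  is \<open>{(m - 1) / 2 ^ k | (m + 1) / 2 ^ k}\<close>.\<close>

fun dyadic_game :: "int \<Rightarrow> nat \<Rightarrow> game" where
  "dyadic_game m 0 = int_game m"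
| "dyadic_game m (Suc k) =
     (if even m then dyadic_game (m div 2) k
      else Game {|dyadic_game ((m - 1) div 2) k|} {|dyadic_game ((m + 1) div 2) k|})"

text \<open>Only meaningful on \<open>dyadics\<close>, where the choice does not matter by \<open>num_game_dyadic\<close>.\<close>

definition num_game :: "real \<Rightarrow> game" where
  "num_game x = (SOME G. \<exists>m k. x = of_int m / 2 ^ k \<and> G = dyadic_game m k)"

lemma dyadic_game_scale: "dyadic_game (m * 2 ^ j) (k + j) = dyadic_game m k"
proof (induction j)
  case (Suc j)
  have "m * 2 ^ Suc j div 2 = m * 2 ^ j" by simp
  then show ?case using Suc by simp
qed simp

lemma num_game_dyadic: "num_game (of_int m / 2 ^ k) = dyadic_game m k"
proof -
  have unique: "dyadic_game m k = dyadic_game m' k'"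
    if "of_int m / 2 ^ k = (of_int m' / 2 ^ k' :: real)" for m' k'
  proof -
    have "(of_int (m * 2 ^ k') :: real) = of_int (m' * 2 ^ k)"
      using that by (simp add: field_simps)
    then have "m * 2 ^ k' = m' * 2 ^ k" by linarith
    then show ?thesis
      using dyadic_game_scale[of m k' k] dyadic_game_scale[of m' k k'] by (simp add: add.commute)
  qed
  show ?thesis
    unfolding num_game_def
  proof (rule some_equality)
    show "\<exists>m' k'. of_int m / 2 ^ k = (of_int m' / 2 ^ k' :: real) \<and> dyadic_game m k = dyadic_game m' k'"
      by blast
  next
    fix G
    assume "\<exists>m' k'. of_int m / 2 ^ k = (of_int m' / 2 ^ k' :: real) \<and> G = dyadic_game m' k'"
    then obtain m' k' where "of_int m / 2 ^ k = (of_int m' / 2 ^ k' :: real)"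
      and G: "G = dyadic_game m' k'"
      by blast
    from unique[OF this(1)] show "G = dyadic_game m k"
      unfolding G by (rule sym)
  qed
qed

definition has_value :: "game \<Rightarrow> real \<Rightarrow> bool" where
  "has_value G x \<longleftrightarrow> x \<in> dyadics \<and> G \<approx> num_game x"


section \<open>Stops\<close>

text \<open>A game form without Left options or without Right options equals an integer, so \<open>Max\<close> and
  \<open>Min\<close> are only evaluated on nonempty sets.\<close>

function left_stop :: "game \<Rightarrow> real" and right_stop :: "game \<Rightarrow> real" where
  "left_stop G = (if \<exists>x. has_value G x then (THE x. has_value G x)
     else Max (right_stop ` fset (lopts G)))"
| "right_stop G = (if \<exists>x. has_value G x then (THE x. has_value G x)
     else Min (left_stop ` fset (ropts G)))"
  by pat_completeness auto
termination
  by (relation "measure (case_sum size size)") (auto dest: size_lopts size_ropts)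

declare left_stop.simps [simp del] right_stop.simps [simp del]

definition infinitesimal :: "game \<Rightarrow> bool" where
  "infinitesimal G \<longleftrightarrow> left_stop G = 0 \<and> right_stop G = 0"

definition inf_close :: "game \<Rightarrow> game \<Rightarrow> bool" where
  "inf_close G H \<longleftrightarrow> infinitesimal (G - H)"

definition close_to_number :: "game \<Rightarrow> real \<Rightarrow> bool" where
  "close_to_number G x \<longleftrightarrow> x \<in> dyadics \<and> inf_close G (num_game x)"


section \<open>Cooling and temperature\<close>

text \<open>\<open>cool G t\<close> is \<open>G\<^sub>t\<close> and \<open>pre_cool G t\<close> is the game written with a tilde, \<open>G\<close> cooled by \<open>t\<close>
  before any freezing. The parameter is a short number, i.e. a dyadic rational, because otherwise
  \<open>G\<^sub>t\<close> would not be a short game.\<close>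

definition cooling_params :: "real set" where
  "cooling_params = {t \<in> dyadics. -1 \<le> t}"

function cool :: "game \<Rightarrow> real \<Rightarrow> game" and pre_cool :: "game \<Rightarrow> real \<Rightarrow> game" where
  "cool G t =
     (if \<exists>n. G \<approx> int_game n then int_game (THE n. G \<approx> int_game n)
      else if \<exists>s\<in>cooling_params. s < t \<and> (\<exists>x. close_to_number (pre_cool G s) x)
      then let s = (LEAST s. s \<in> cooling_params \<and> s < t \<and> (\<exists>x. close_to_number (pre_cool G s) x))
           in num_game (THE x. close_to_number (pre_cool G s) x)
      else pre_cool G t)"
| "pre_cool G t =
     Game ((\<lambda>G'. cool G' t - num_game t) |`| lopts G) ((\<lambda>G'. cool G' t + num_game t) |`| ropts G)"
  by pat_completeness auto
termination
  by (relation "measure (case_sum (\<lambda>(G, t). 2 * size G + 1) (\<lambda>(G, t). 2 * size G))")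
    (auto dest!: size_lopts size_ropts)

declare cool.simps [simp del] pre_cool.simps [simp del]

definition temperature :: "game \<Rightarrow> real" where
  "temperature G = (LEAST t. t \<in> cooling_params \<and> (\<exists>x. close_to_number (cool G t) x))"


section \<open>Snort\<close>

datatype player = Left | Right

primrec opponent :: "player \<Rightarrow> player" where
  "opponent Left = Right"
| "opponent Right = Left"

definition snort_moves ::
    "'v fset \<Rightarrow> ('v \<Rightarrow> 'v \<Rightarrow> bool) \<Rightarrow> ('v \<Rightarrow> player option) \<Rightarrow> player \<Rightarrow> 'v fset" where
  "snort_moves V adj c p =
     ffilter (\<lambda>v. c v = None \<and> (\<forall>u. u |\<in>| V \<and> adj u v \<longrightarrow> c u \<noteq> Some (opponent p))) V"

text \<open>The position on the graph with vertices \<open>V\<close> and symmetric adjacency relation \<open>adj\<close> in which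
  \<open>c v\<close> is the owner of the piece on \<open>v\<close>, if any.\<close>

function snort ::
    "'v fset \<Rightarrow> ('v \<Rightarrow> 'v \<Rightarrow> bool) \<Rightarrow> ('v \<Rightarrow> player option) \<Rightarrow> game" where
  "snort V adj c = Game
     ((\<lambda>v. snort V adj (c(v \<mapsto> Left))) |`| snort_moves V adj c Left)
     ((\<lambda>v. snort V adj (c(v \<mapsto> Right))) |`| snort_moves V adj c Right)"
  by pat_completeness auto
termination
proof (relation "measure (\<lambda>(V, adj, c). card {v \<in> fset V. c v = None})", goal_cases)
  case (2 V adj c v)
  then show ?case
    by (auto simp: snort_moves_def intro!: psubset_card_mono)
next
  case (3 V adj c v)
  then show ?case
    by (auto simp: snort_moves_def intro!: psubset_card_mono)
qed simp

declare snort.simps [simp del]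

definition snort_empty_path :: "nat \<Rightarrow> game" where
  "snort_empty_path n = snort (fset_of_list [0..<n]) (\<lambda>i j. j = Suc i \<or> i = Suc j) Map.empty"

end

theory Submission
  imports Defs
begin

text \<open>A position that is antisymmetric under reflection of the path equals its own negative, so its
  mean is 0, and it is frozen at temperature \<open>t\<close> as soon as \<open>RS(G\<^sup>L\<^sub>t) \<le> t\<close> for all \<open>G\<^sup>L\<close>. If Right can
  mirror Left's move, the answer is antisymmetric again, and \<open>RS(G\<^sup>L\<^sub>t) \<le> LS(G\<^sup>L\<^sup>R\<^sub>t) + t = t\<close> by induction.
  Mirroring only fails for moves at the centre, after which \<open>G\<^sup>L \<le> 7\<close>: Right keeps mirroring away
  from the centre and needs at most seven free moves to seal the centre off. As cooling respects upper bounds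
  by integers, \<open>RS(G\<^sup>L\<^sub>t) \<le> 7 \<le> t\<close> for \<open>t = 15 / 2\<close>.

  Stops are handled as Dedekind cuts: \<open>LS(G)\<close> is the infimum of the dyadics \<open>x \<ge> G\<close>, which makes their
  translation by numbers a consequence of the group laws.\<close>

section \<open>The ordered monoid of game forms\<close>

text \<open>The main obstacle is that cooling and temperature are defined by a \<open>LEAST\<close>
  over dyadic temperatures. The walls of a thermograph must therefore be shown to meet at a dyadic,
  and to be strictly apart at -1 unless the game is an integer. The first needs the piecewise linear
  shape of the walls, the second the exact effect of cooling by -1. Of the monotonicity of cooling,
  only the part about integer upper bounds is established; integers are the games whose cooled form
  is known outright. The constant 7 is 1 + 6. After a move at the centre, the block made of the
  chosen vertex and its mirror image has at most one empty vertex. Six more free moves let Right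
  enclose that block in a wider one with a Right piece at one end: widening by three vertices on
  each side adds at most five empty vertices, and Right passes once on the path. The value 15/2
  enters only as a dyadic that is at least 7.\<close>

lemma game_le_iff:
  "G \<le> H \<longleftrightarrow> (\<forall>G'. G' |\<in>| lopts G \<longrightarrow> \<not> H \<le> G') \<and> (\<forall>H'. H' |\<in>| ropts H \<longrightarrow> \<not> H' \<le> G)" for G H :: game
  unfolding less_eq_game_def by (rule game_le.simps)

lemma game_refl: "G \<le> G" for G :: game
proof (induction "size G" arbitrary: G rule: less_induct)
  case less
  show ?case
    by (subst game_le_iff) (metis game_le_iff less size_lopts size_ropts)
qed

lemma game_trans: "G \<le> H \<Longrightarrow> H \<le> K \<Longrightarrow> G \<le> K" for G H K :: game
proof (induction "size G + size H + size K" arbitrary: G H K rule: less_induct)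
  case less
  show ?case
  proof (subst game_le_iff, intro conjI allI impI notI)
    fix G' assume "G' |\<in>| lopts G" "K \<le> G'"
    \<comment> \<open>The induction hypothesis at the rotated triple (H, K, G') gives
      \<open>H \<le> G'\<close>, which \<open>G \<le> H\<close> forbids.\<close>
    with less.hyps[of H K G'] less.prems size_lopts[of G' G] show False
      by (metis game_le_iff add.commute add.left_commute add_less_cancel_left)
  next
    fix K' assume "K' |\<in>| ropts K" "K' \<le> G"
    with less.hyps[of K' G H] less.prems size_ropts[of K' K] show False
      by (metis game_le_iff add.commute add.left_commute add_less_cancel_left)
  qed
qed

instance game :: preorder
  by standard (auto simp: less_game_def intro: game_refl game_trans)

lemma not_ge_lopt: "G' |\<in>| lopts G \<Longrightarrow> \<not> G \<le> G'"
  and not_ropt_le: "G' |\<in>| ropts G \<Longrightarrow> \<not> G' \<le> G" for G :: game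
  using game_le_iff[of G G] game_refl by auto

lemma lopts_add: "lopts (G + H) = (\<lambda>G'. G' + H) |`| lopts G |\<union>| (\<lambda>H'. G + H') |`| lopts H"
  and ropts_add: "ropts (G + H) = (\<lambda>G'. G' + H) |`| ropts G |\<union>| (\<lambda>H'. G + H') |`| ropts H"
  for G H :: game
  unfolding plus_game_def by (subst game_add.simps, simp)+

lemma lopts_neg: "lopts (- G) = uminus |`| ropts G"
  and ropts_neg: "ropts (- G) = uminus |`| lopts G" for G :: game
  unfolding uminus_game_def by (cases G; simp)+

lemma lopts_zero [simp]: "lopts 0 = {||}" and ropts_zero [simp]: "ropts 0 = {||}"
  unfolding zero_game_def by simp_all

lemma lopts_addI: "G' |\<in>| lopts G \<Longrightarrow> G' + H |\<in>| lopts (G + H)"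
    "H' |\<in>| lopts H \<Longrightarrow> G + H' |\<in>| lopts (G + H)"
  and ropts_addI: "G' |\<in>| ropts G \<Longrightarrow> G' + H |\<in>| ropts (G + H)"
    "H' |\<in>| ropts H \<Longrightarrow> G + H' |\<in>| ropts (G + H)" for G H :: game
  by (auto simp: lopts_add ropts_add)

lemma game_eqI: "lopts G = lopts H \<Longrightarrow> ropts G = ropts H \<Longrightarrow> G = H"
  by (rule game.expand) simp

lemma fimage_cong': "(\<And>x. x |\<in>| A \<Longrightarrow> f x = g x) \<Longrightarrow> f |`| A = g |`| A"
  by (rule fset.map_cong) auto

text \<open>The monoid laws and the laws of negation hold for forms, with HOL equality, so a type
  class instance is possible; only the cancellation of \<open>G - G\<close> is restricted to
  \<open>\<approx>\<close>.\<close>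

lemma game_add_commute: "G + H = H + G" for G H :: game
proof (induction "size G + size H" arbitrary: G H rule: less_induct)
  case less
  have *: "(\<lambda>G'. G' + H) |`| lopts G = (\<lambda>G'. H + G') |`| lopts G"
    "(\<lambda>G'. G' + H) |`| ropts G = (\<lambda>G'. H + G') |`| ropts G"
    "(\<lambda>H'. G + H') |`| lopts H = (\<lambda>H'. H' + G) |`| lopts H"
    "(\<lambda>H'. G + H') |`| ropts H = (\<lambda>H'. H' + G) |`| ropts H"
    by (rule fimage_cong', rule less, simp add: size_lopts size_ropts)+
  show ?case
    by (rule game_eqI) (simp_all add: lopts_add ropts_add * sup_commute)
qed

lemma game_add_assoc: "G + H + K = G + (H + K)" for G H K :: game
proof (induction "size G + size H + size K" arbitrary: G H K rule: less_induct)
  case less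
  have *: "(\<lambda>x. x + H + K) |`| lopts G = (\<lambda>x. x + (H + K)) |`| lopts G"
    "(\<lambda>x. x + H + K) |`| ropts G = (\<lambda>x. x + (H + K)) |`| ropts G"
    "(\<lambda>x. G + x + K) |`| lopts H = (\<lambda>x. G + (x + K)) |`| lopts H"
    "(\<lambda>x. G + x + K) |`| ropts H = (\<lambda>x. G + (x + K)) |`| ropts H"
    "(\<lambda>x. G + H + x) |`| lopts K = (\<lambda>x. G + (H + x)) |`| lopts K"
    "(\<lambda>x. G + H + x) |`| ropts K = (\<lambda>x. G + (H + x)) |`| ropts K"
    by (rule fimage_cong', rule less, simp add: size_lopts size_ropts)+
  show ?case
    by (rule game_eqI)
      (simp_all add: lopts_add ropts_add fimage_funion fset.map_comp comp_def * sup_assoc)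
qed

lemma game_add_0: "0 + G = G" for G :: game
proof (induction "size G" arbitrary: G rule: less_induct)
  case less
  have "(\<lambda>x. 0 + x) |`| lopts G = (\<lambda>x. x) |`| lopts G" "(\<lambda>x. 0 + x) |`| ropts G = (\<lambda>x. x) |`| ropts G"
    by (rule fimage_cong', rule less, simp add: size_lopts size_ropts)+
  then show ?case
    by (intro game_eqI) (simp_all add: lopts_add ropts_add)
qed

instance game :: comm_monoid_add
  by standard (rule game_add_assoc game_add_commute game_add_0)+

lemma game_neg_neg [simp]: "- (- G) = G" for G :: game
proof (induction "size G" arbitrary: G rule: less_induct)
  case less
  have "(\<lambda>x. - (- x)) |`| lopts G = (\<lambda>x. x) |`| lopts G" "(\<lambda>x. - (- x)) |`| ropts G = (\<lambda>x. x) |`| ropts G"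
    by (rule fimage_cong', rule less, simp add: size_lopts size_ropts)+
  then show ?case
    by (intro game_eqI) (simp_all add: lopts_neg ropts_neg fset.map_comp comp_def)
qed

lemma game_neg_0 [simp]: "- 0 = (0 :: game)"
  by (rule game_eqI) (simp_all add: lopts_neg ropts_neg)

lemma game_neg_add: "- (G + H) = - G + - H" for G H :: game
proof (induction "size G + size H" arbitrary: G H rule: less_induct)
  case less
  have *: "(\<lambda>x. - (x + H)) |`| lopts G = (\<lambda>x. - x + - H) |`| lopts G"
    "(\<lambda>x. - (x + H)) |`| ropts G = (\<lambda>x. - x + - H) |`| ropts G"
    "(\<lambda>x. - (G + x)) |`| lopts H = (\<lambda>x. - G + - x) |`| lopts H"
    "(\<lambda>x. - (G + x)) |`| ropts H = (\<lambda>x. - G + - x) |`| ropts H"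
    by (rule fimage_cong', rule less, simp add: size_lopts size_ropts)+
  show ?case
    by (rule game_eqI)
      (simp_all add: lopts_add ropts_add lopts_neg ropts_neg fimage_funion fset.map_comp comp_def *)
qed

lemma game_neg_le_iff: "- G \<le> - H \<longleftrightarrow> H \<le> G" for G H :: game
proof (induction "size G + size H" arbitrary: G H rule: less_induct)
  case less
  have "- H \<le> - G' \<longleftrightarrow> G' \<le> H" if "G' |\<in>| ropts G" for G'
    using less[of H G'] size_ropts[OF that] by simp
  moreover have "- H' \<le> - G \<longleftrightarrow> G \<le> H'" if "H' |\<in>| lopts H" for H'
    using less[of H' G] size_lopts[OF that] by simp
  ultimately show ?case
    unfolding game_le_iff[of "- G" "- H"] game_le_iff[of H G] by (auto simp: lopts_neg ropts_neg)
qed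

lemma game_neg_le_iff': "- G \<le> H \<longleftrightarrow> - H \<le> G" for G H :: game
  using game_neg_le_iff[of G "- H"] by simp

text \<open>Does the work of cancelling \<open>K - K\<close>. A move in \<open>K\<close> alone is
  met by the same move on the other side: \<open>H + K \<le> G + K'\<close> would imply
  \<open>H + K \<le> H + K'\<close>, although \<open>H + K'\<close> is a Left option of
  \<open>H + K\<close>.\<close>

lemma game_add_le_cancel: "G + K \<le> H + K \<longleftrightarrow> G \<le> H" for G H K :: game
proof (induction "size G + size H + size K" arbitrary: G H K rule: less_induct)
  case less
  have GK: "H + K \<le> G' + K \<longleftrightarrow> H \<le> G'" if "G' |\<in>| lopts G" for G'
    using less[of H G' K] size_lopts[OF that] by simp
  have HK: "H' + K \<le> G + K \<longleftrightarrow> H' \<le> G" if "H' |\<in>| ropts H" for H'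
    using less[of H' G K] size_ropts[OF that] by simp
  have K': "G + K' \<le> H + K' \<longleftrightarrow> G \<le> H" if "K' |\<in>| lopts K \<or> K' |\<in>| ropts K" for K'
    using less[of G H K'] size_lopts[of K' K] size_ropts[of K' K] that by auto
  show ?case
  proof
    assume "G + K \<le> H + K"
    then show "G \<le> H"
      unfolding game_le_iff[of "G + K"] game_le_iff[of G] using GK HK
      by (auto simp: lopts_add ropts_add)
  next
    assume le: "G \<le> H"
    have "\<not> H + K \<le> G + K'" if "K' |\<in>| lopts K" for K'
      using K'[of K'] that le lopts_addI(2)[OF that, of H] by (meson not_ge_lopt order_trans)
    moreover have "\<not> H + K' \<le> G + K" if "K' |\<in>| ropts K" for K'
      using K'[of K'] that le ropts_addI(2)[OF that, of G] by (meson not_ropt_le order_trans)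
    ultimately show "G + K \<le> H + K"
      unfolding game_le_iff[of "G + K"] using GK HK le[unfolded game_le_iff[of G]]
      by (auto simp: lopts_add ropts_add)
  qed
qed

lemma game_eq_refl [simp]: "G \<approx> G"
  and game_eq_sym: "G \<approx> H \<Longrightarrow> H \<approx> G"
  and game_eq_trans: "G \<approx> H \<Longrightarrow> H \<approx> K \<Longrightarrow> G \<approx> K"
  and game_eq_neg_iff: "- G \<approx> - H \<longleftrightarrow> G \<approx> H"
  unfolding game_eq_def using game_neg_le_iff by (auto intro: order_trans)

section \<open>Numbers\<close>

lemma dyadicsI: "x = of_int m / 2 ^ k \<Longrightarrow> x \<in> dyadics"
  unfolding dyadics_def by blast

lemma dyadics_of_int [simp]: "of_int m \<in> dyadics"
  by (rule dyadicsI[of _ m 0]) simp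

lemma dyadics_0 [simp]: "0 \<in> dyadics"
  using dyadics_of_int[of 0] by simp

lemma dyadics_minus [simp]: "- x \<in> dyadics \<longleftrightarrow> x \<in> dyadics"
proof -
  have "- x \<in> dyadics" if x: "x \<in> dyadics" for x
  proof -
    obtain m k where "x = of_int m / 2 ^ k"
      using x unfolding dyadics_def by blast
    then show ?thesis
      by (intro dyadicsI[of _ "- m" k]) simp
  qed
  from this[of x] this[of "- x"] show ?thesis by auto
qed

lemma dyadics_add [simp]:
  assumes "x \<in> dyadics" "y \<in> dyadics"
  shows "x + y \<in> dyadics"
proof -
  obtain m k n j where "x = of_int m / 2 ^ k" "y = of_int n / 2 ^ j"
    using assms unfolding dyadics_def by blast
  then have "x + y = of_int (m * 2 ^ j + n * 2 ^ k) / 2 ^ (k + j)"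
    by (simp add: add_divide_distrib power_add)
  then show ?thesis by (rule dyadicsI)
qed

lemma dyadics_diff [simp]: "x \<in> dyadics \<Longrightarrow> y \<in> dyadics \<Longrightarrow> x - y \<in> dyadics"
  using dyadics_add[of x "- y"] by simp

lemma dyadics_dense:
  fixes a b :: real
  assumes "a < b"
  obtains x where "x \<in> dyadics" "a < x" "x < b"
proof -
  obtain k where k: "(1 / 2) ^ k < b - a"
    using real_arch_pow_inv[of "b - a" "1 / 2"] assms by auto
  define m where "m = \<lfloor>a * 2 ^ k\<rfloor> + 1"
  have "a * 2 ^ k < m" "m \<le> a * 2 ^ k + 1"
    unfolding m_def by linarith+
  then have "a < of_int m / 2 ^ k" "of_int m / 2 ^ k \<le> a + (1 / 2) ^ k"
    by (simp_all add: field_simps power_divide)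
  with k show ?thesis
    by (intro that[of "of_int m / 2 ^ k"]) (auto intro: dyadicsI)
qed

text \<open>The canonical form of the dyadic \<open>x\<close> has options \<open>x \<plusminus> ulp x\<close>, apart from the integers,
  which have at most one option.\<close>

definition den :: "real \<Rightarrow> nat" where
  "den x = (LEAST k. x * 2 ^ k \<in> \<int>)"

definition ulp :: "real \<Rightarrow> real" where
  "ulp x = 1 / 2 ^ den x"

lemma ulp_pos [simp]: "0 < ulp x"
  by (simp add: ulp_def)

lemma ulp_dyadics [simp]: "ulp x \<in> dyadics"
  unfolding ulp_def by (rule dyadicsI[of _ 1]) simp

lemma den_iff:
  assumes "x \<in> dyadics"
  shows "x * 2 ^ k \<in> \<int> \<longleftrightarrow> den x \<le> k"
proof
  show "den x \<le> k" if "x * 2 ^ k \<in> \<int>"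
    unfolding den_def using that by (rule Least_le)
next
  assume le: "den x \<le> k"
  obtain m j where "x = of_int m / 2 ^ j"
    using assms unfolding dyadics_def by blast
  then have "x * 2 ^ j \<in> \<int>" by simp
  then have "x * 2 ^ den x \<in> \<int>"
    unfolding den_def by (rule LeastI)
  then have "x * 2 ^ den x * 2 ^ (k - den x) \<in> \<int>" by simp
  then show "x * 2 ^ k \<in> \<int>"
    using le by (simp add: mult.assoc flip: power_add)
qed

lemma den_eq_0_iff: "x \<in> dyadics \<Longrightarrow> den x = 0 \<longleftrightarrow> x \<in> \<int>"
  using den_iff[of x 0] by simp

lemma den_add_le:
  assumes "x \<in> dyadics" "y \<in> dyadics"
  shows "den (x + y) \<le> max (den x) (den y)"
proof -
  have "x * 2 ^ max (den x) (den y) \<in> \<int>" "y * 2 ^ max (den x) (den y) \<in> \<int>"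
    using assms by (simp_all add: den_iff)
  then have "(x + y) * 2 ^ max (den x) (den y) \<in> \<int>"
    by (simp add: distrib_right)
  then show ?thesis
    using den_iff assms by simp
qed

lemma den_minus [simp]: "den (- x) = den x"
  unfolding den_def by simp

lemma ulp_minus [simp]: "ulp (- x) = ulp x"
  by (simp add: ulp_def)

lemma ulp_le_iff: "ulp x \<le> ulp y \<longleftrightarrow> den y \<le> den x"
  unfolding ulp_def by (simp add: field_simps)

lemma dyadic_gap:
  assumes "x \<in> dyadics" "y \<in> dyadics" "y < x" "den x \<le> k" "den y \<le> k"
  shows "y + 1 / 2 ^ k \<le> x"
proof -
  obtain m n :: int where "x * 2 ^ k = m" "y * 2 ^ k = n"
    using assms den_iff by (metis Ints_cases)
  then have *: "x = m / 2 ^ k" "y = n / 2 ^ k" by (simp_all add: field_simps)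
  then have "n < m" using assms(3) by (simp add: divide_less_cancel)
  then have "real_of_int n + 1 \<le> real_of_int m" by simp
  then show ?thesis unfolding * by (simp add: divide_right_mono flip: add_divide_distrib)
qed

lemma dyadic_game_neg: "dyadic_game (- m) k = - dyadic_game m k"
proof (induction k arbitrary: m)
  case (Suc k)
  show ?case
  proof (cases "even m")
    case True
    then show ?thesis using Suc[of "m div 2"] by (auto elim!: evenE simp flip: mult_minus_right)
  next
    case False
    then have "(- m - 1) div 2 = - ((m + 1) div 2)" "(- m + 1) div 2 = - ((m - 1) div 2)" by presburger+
    then have "dyadic_game ((- m - 1) div 2) k = - dyadic_game ((m + 1) div 2) k"
      "dyadic_game ((- m + 1) div 2) k = - dyadic_game ((m - 1) div 2) k"
      by (simp_all only: Suc)
    then show ?thesis using False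
      by (intro game_eqI) (simp_all add: lopts_neg ropts_neg)
  qed
qed (simp add: int_game_def game_neg_0)

lemma num_neg: "x \<in> dyadics \<Longrightarrow> num_game (- x) = - num_game x"
proof -
  assume "x \<in> dyadics"
  then obtain m k where x: "x = of_int m / 2 ^ k"
    unfolding dyadics_def by blast
  then have "- x = of_int (- m) / 2 ^ k" by simp
  with x show ?thesis
    by (simp only: num_game_dyadic dyadic_game_neg)
qed

lemma num_int: "num_game (of_int n) = int_game n"
  using num_game_dyadic[of n 0] by simp

lemma num_0 [simp]: "num_game 0 = 0"
  using num_int[of 0] by (simp add: int_game_def)

lemma num_nat: "num_game (of_nat n) = nat_game n"
  using num_int[of "int n"] by (simp add: int_game_def)

text \<open>Replaces the recursion of \<open>dyadic_game\<close> on a chosen fraction by arithmetic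
  on the real number itself.\<close>

lemma lopts_num:
  assumes "x \<in> dyadics"
  shows "lopts (num_game x) = (if x \<in> \<int> \<and> x \<le> 0 then {||} else {|num_game (x - ulp x)|})"
proof (cases "den x")
  case 0
  then obtain n where n: "x = of_int n" using assms by (auto simp: den_eq_0_iff elim: Ints_cases)
  have u: "ulp x = 1" using 0 by (simp add: ulp_def)
  show ?thesis
  proof (cases "n \<le> 0")
    case True
    then have "num_game x = - nat_game (nat (- n))"
      using num_int[of n] n by (auto simp: int_game_def)
    then show ?thesis using n True
      by (cases "nat (- n)") (simp_all add: lopts_neg)
  next
    case False
    then obtain k where k: "n = int (Suc k)" by (metis not_le zero_less_imp_eq_int gr0_conv_Suc)
    have "x = of_nat (Suc k)"
      by (simp add: n k)
    moreover have "x - ulp x = of_nat k"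
      unfolding u by (simp add: n k)
    ultimately have "num_game x = nat_game (Suc k)" "num_game (x - ulp x) = nat_game k"
      by (simp_all only: num_nat)
    then show ?thesis using n k by simp
  qed
next
  case (Suc k)
  obtain m :: int where m: "x * 2 ^ Suc k = m"
    using den_iff[OF assms, of "Suc k"] Suc by (auto elim: Ints_cases)
  then have xm: "x = m / 2 ^ Suc k" by (simp add: field_simps)
  \<comment> \<open>Minimality of \<open>den x\<close> makes the numerator odd, which selects the
    clause of \<open>dyadic_game\<close> with two options.\<close>
  have "x * 2 ^ k \<notin> \<int>" using den_iff[OF assms, of k] Suc by simp
  then have odd: "odd m" using xm by (auto elim!: evenE)
  have "x - ulp x = of_int (m - 1) / 2 ^ Suc k"
    unfolding ulp_def Suc unfolding xm by (simp add: diff_divide_distrib)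
  also have "\<dots> = of_int ((m - 1) div 2) / 2 ^ k"
    using odd by (auto elim!: oddE)
  finally have "num_game (x - ulp x) = dyadic_game ((m - 1) div 2) k"
    by (simp only: num_game_dyadic)
  moreover have "num_game x = dyadic_game m (Suc k)"
    unfolding xm by (rule num_game_dyadic)
  moreover have "x \<notin> \<int>" using den_eq_0_iff[OF assms] Suc by simp
  ultimately show ?thesis using odd by simp
qed

lemma ropts_num:
  assumes "x \<in> dyadics"
  shows "ropts (num_game x) = (if x \<in> \<int> \<and> x \<ge> 0 then {||} else {|num_game (x + ulp x)|})"
proof -
  have "num_game x = - num_game (- x)" using num_neg[of "- x"] assms by simp
  moreover have "- num_game (- x - ulp x) = num_game (x + ulp x)"
    using num_neg[of "- x - ulp x"] assms by (simp add: add.commute)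
  ultimately show ?thesis
    using lopts_num[of "- x"] assms by (simp add: ropts_neg)
qed

section \<open>Order and addition of numbers\<close>

text \<open>If y < x, the one with the larger denominator has an \<open>ulp\<close> of at most x -
  y, so its option towards the other refutes \<open>num_game x \<le> num_game y\<close>. If both are
  integers, one of them has such an option because x \<le> 0 \<le> y is excluded.\<close>

lemma num_le_iff:
  "x \<in> dyadics \<Longrightarrow> y \<in> dyadics \<Longrightarrow> num_game x \<le> num_game y \<longleftrightarrow> x \<le> y"
proof (induction "size (num_game x) + size (num_game y)" arbitrary: x y rule: less_induct)
  case less
  note d = less.prems
  have L: "num_game y \<le> num_game (x - ulp x) \<longleftrightarrow> y \<le> x - ulp x" if "\<not> (x \<in> \<int> \<and> x \<le> 0)"
    using less.hyps[of y "x - ulp x"] size_lopts[of "num_game (x - ulp x)" "num_game x"] d that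
    by (auto simp: lopts_num)
  have R: "num_game (y + ulp y) \<le> num_game x \<longleftrightarrow> y + ulp y \<le> x" if "\<not> (y \<in> \<int> \<and> y \<ge> 0)"
    using less.hyps[of "y + ulp y" x] size_ropts[of "num_game (y + ulp y)" "num_game y"] d that
    by (auto simp: ropts_num)
  have "num_game x \<le> num_game y \<longleftrightarrow>
      (\<not> (x \<in> \<int> \<and> x \<le> 0) \<longrightarrow> \<not> y \<le> x - ulp x) \<and> (\<not> (y \<in> \<int> \<and> y \<ge> 0) \<longrightarrow> \<not> y + ulp y \<le> x)"
    unfolding game_le_iff[of "num_game x"] using L R d by (auto simp: lopts_num ropts_num)
  also have "\<dots> \<longleftrightarrow> x \<le> y"
  proof
    assume *: "(\<not> (x \<in> \<int> \<and> x \<le> 0) \<longrightarrow> \<not> y \<le> x - ulp x) \<and> (\<not> (y \<in> \<int> \<and> y \<ge> 0) \<longrightarrow> \<not> y + ulp y \<le> x)"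
    show "x \<le> y"
    proof (rule ccontr)
      assume "\<not> x \<le> y"
      then have "y < x" by simp
      have "y + ulp x \<le> x" if "den y \<le> den x"
        using dyadic_gap[of x y "den x"] d \<open>y < x\<close> that by (simp add: ulp_def)
      moreover have "y + ulp y \<le> x" if "den x \<le> den y"
        using dyadic_gap[of x y "den y"] d \<open>y < x\<close> that by (simp add: ulp_def)
      ultimately show False
        using * \<open>y < x\<close> den_eq_0_iff d by (cases "den x" "den y" rule: linorder_cases) fastforce+
    qed
  qed (use ulp_pos[of x] ulp_pos[of y] in linarith)
  finally show ?case .
qed

text \<open>Symmetrised so that an induction may pass to \<open>- G\<close> without comparing
  \<open>size (- G)\<close> with \<open>size G\<close>.\<close>

definition nsize :: "game \<Rightarrow> nat" where
  "nsize G = size G + size (- G)"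

lemma nsize_neg [simp]: "nsize (- G) = nsize G"
  by (simp add: nsize_def)

lemma nsize_lopts: "G' |\<in>| lopts G \<Longrightarrow> nsize G' < nsize G"
  and nsize_ropts: "G' |\<in>| ropts G \<Longrightarrow> nsize G' < nsize G"
  unfolding nsize_def
  by (intro add_strict_mono size_lopts size_ropts, simp_all add: lopts_neg ropts_neg)+

text \<open>The induction hypothesis is an assumption here because \<open>num_add\<close> uses this
  half twice: for x and y, and for - x and - y to get the other half by negation.\<close>

lemma num_add_le:
  assumes "\<And>x' y'. x' \<in> dyadics \<Longrightarrow> y' \<in> dyadics \<Longrightarrow>
      nsize (num_game x') + nsize (num_game y') < nsize (num_game x) + nsize (num_game y) \<Longrightarrow>
      num_game x' + num_game y' \<approx> num_game (x' + y')"
    and d: "x \<in> dyadics" "y \<in> dyadics"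
  shows "num_game x + num_game y \<le> num_game (x + y)"
proof (subst game_le_iff, intro conjI allI impI)
  fix G' assume "G' |\<in>| lopts (num_game x + num_game y)"
  then obtain x' y' where G': "G' = num_game x' + num_game y'" "x' \<in> dyadics" "y' \<in> dyadics" "x' + y' < x + y"
    and s: "nsize (num_game x') + nsize (num_game y') < nsize (num_game x) + nsize (num_game y)"
  proof (auto simp: lopts_add, goal_cases)
    case (1 H)
    then show ?case
      using 1(1)[of "x - ulp x" y] nsize_lopts[OF 1(2)] d by (auto simp: lopts_num split: if_splits)
  next
    case (2 H)
    then show ?case
      using 2(1)[of x "y - ulp y"] nsize_lopts[OF 2(2)] d by (auto simp: lopts_num split: if_splits)
  qed
  then have "G' \<le> num_game (x' + y')" "\<not> num_game (x + y) \<le> num_game (x' + y')"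
    using assms(1)[of x' y'] d by (simp_all add: game_eq_def num_le_iff)
  then show "\<not> num_game (x + y) \<le> G'" by (meson order_trans)
next
  fix H' assume H': "H' |\<in>| ropts (num_game (x + y))"
  define z where "z = x + y + ulp (x + y)"
  have z: "H' = num_game z" "\<not> (x + y \<in> \<int> \<and> x + y \<ge> 0)" "z \<in> dyadics"
    using H' d unfolding z_def by (auto simp: ropts_num split: if_splits)
  \<comment> \<open>The denominator of a sum is at most the larger of the two, so moving Right in
    the finer summand overshoots x + y by at most \<open>ulp (x + y)\<close>. If both are integers,
    x + y is negative, hence so is one of them.\<close>
  have "ulp x \<le> ulp (x + y) \<and> \<not> (x \<in> \<int> \<and> x \<ge> 0) \<or> ulp y \<le> ulp (x + y) \<and> \<not> (y \<in> \<int> \<and> y \<ge> 0)"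
  proof (cases "den y \<le> den x")
    case True
    then show ?thesis
      using den_add_le[OF d] z(2) den_eq_0_iff d by (fastforce simp: ulp_le_iff)
  next
    case False
    then show ?thesis
      using den_add_le[OF d] z(2) den_eq_0_iff[OF d(2)] by (auto simp: ulp_le_iff)
  qed
  then obtain x' y' where xy': "num_game x' + num_game y' |\<in>| ropts (num_game x + num_game y)"
      "x' \<in> dyadics" "y' \<in> dyadics" "x' + y' \<le> z"
    and s: "nsize (num_game x') + nsize (num_game y') < nsize (num_game x) + nsize (num_game y)"
  proof (elim disjE conjE, goal_cases)
    case 1
    then have *: "num_game (x + ulp x) |\<in>| ropts (num_game x)"
      using d by (simp add: ropts_num)
    show ?case
      using 1(1)[of "x + ulp x" y, OF ropts_addI(1)[OF *]] 1(2) nsize_ropts[OF *] d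
      unfolding z_def by simp
  next
    case 2
    then have *: "num_game (y + ulp y) |\<in>| ropts (num_game y)"
      using d by (simp add: ropts_num)
    show ?case
      using 2(1)[of x "y + ulp y", OF ropts_addI(2)[OF *]] 2(2) nsize_ropts[OF *] d
      unfolding z_def by simp
  qed
  have "num_game x' + num_game y' \<le> num_game (x' + y')"
    using assms(1)[OF xy'(2,3) s] by (simp add: game_eq_def)
  also have "\<dots> \<le> H'"
    using xy' z by (simp add: num_le_iff)
  finally show "\<not> H' \<le> num_game x + num_game y"
    using not_ropt_le[OF xy'(1)] by (meson order_trans)
qed

lemma num_add:
  "x \<in> dyadics \<Longrightarrow> y \<in> dyadics \<Longrightarrow> num_game x + num_game y \<approx> num_game (x + y)"
proof (induction "nsize (num_game x) + nsize (num_game y)" arbitrary: x y rule: less_induct)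
  case less
  have "num_game x + num_game y \<le> num_game (x + y)"
    by (rule num_add_le) (use less in auto)
  moreover have "num_game (- x) + num_game (- y) \<le> num_game (- x + - y)"
    by (rule num_add_le) (use less in \<open>auto simp: num_neg\<close>)
  then have "- (num_game x + num_game y) \<le> - num_game (x + y)"
    using less.prems num_neg[of "x + y"] by (simp add: num_neg game_neg_add)
  ultimately show ?case
    by (simp add: game_eq_def game_neg_le_iff)
qed

section \<open>The simplicity theorem\<close>

lemma fset_eq_empty_iff: "fset A = {} \<longleftrightarrow> A = {||}"
  by (metis bot_fset.rep_eq fset_inject)

lemma le_nat_game_size: "G \<le> nat_game (size G)"
proof (induction "size G" arbitrary: G rule: less_induct)
  case less
  have "ropts (nat_game (size G)) = {||}"
    using ropts_num[of "of_nat (size G)"] dyadics_of_int[of "int (size G)"] by (simp flip: num_nat)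
  moreover have "\<not> nat_game (size G) \<le> G'" if "G' |\<in>| lopts G" for G'
  proof
    assume "nat_game (size G) \<le> G'"
    also have "G' \<le> nat_game (size G')"
      by (rule less) (rule size_lopts[OF that])
    finally show False
      using size_lopts[OF that] num_le_iff[of "of_nat (size G)" "of_nat (size G')"]
        dyadics_of_int[of "int (size G)"] dyadics_of_int[of "int (size G')"]
      by (simp flip: num_nat)
  qed
  ultimately show ?case
    by (subst game_le_iff) simp
qed

lemma game_bounded_above: obtains n :: nat where "G \<le> num_game (of_nat n)"
  using le_nat_game_size[of G] by (metis num_nat)

text \<open>The condition of the simplicity theorem: the halves of \<open>G \<le> num_game x\<close>
  and \<open>num_game x \<le> G\<close> that concern the options of \<open>G\<close>.\<close>

definition fits :: "game \<Rightarrow> real \<Rightarrow> bool" where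
  "fits G x \<longleftrightarrow> (\<forall>G'. G' |\<in>| lopts G \<longrightarrow> \<not> num_game x \<le> G') \<and> (\<forall>G'. G' |\<in>| ropts G \<longrightarrow> \<not> G' \<le> num_game x)"

text \<open>Conway's simplicity theorem. An option X' of the canonical form of x is smaller, so it
  does not fit; the option of \<open>G\<close> that shows this either contradicts the fit of x or
  refutes the comparison of X' with \<open>G\<close>.\<close>

lemma simplest_fit:
  assumes x: "x \<in> dyadics" "fits G x"
    and min: "\<And>y. y \<in> dyadics \<Longrightarrow> fits G y \<Longrightarrow> size (num_game x) \<le> size (num_game y)"
  shows "G \<approx> num_game x"
proof -
  have 1: "\<not> X' \<le> G" if "X' |\<in>| ropts (num_game x)" for X'
  proof
    assume le: "X' \<le> G"
    have X': "X' = num_game (x + ulp x)"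
      using that x(1) by (auto simp: ropts_num split: if_splits)
    have "\<not> fits G (x + ulp x)"
      using min[of "x + ulp x"] size_ropts[OF that] x(1) unfolding X' by auto
    then consider G' where "G' |\<in>| lopts G" "X' \<le> G'" | G' where "G' |\<in>| ropts G" "G' \<le> X'"
      unfolding fits_def X' by blast
    then show False
    proof cases
      case 1
      have "num_game x \<le> X'"
        using x(1) ulp_pos[of x] unfolding X' by (simp add: num_le_iff less_imp_le)
      then show False
        using 1 x(2) order_trans[of "num_game x" X' G'] unfolding fits_def by blast
    next
      case 2
      then show False
        using not_ropt_le[OF 2(1)] order_trans[OF 2(2) le] by blast
    qed
  qed
  have 2: "\<not> G \<le> X'" if "X' |\<in>| lopts (num_game x)" for X'
  proof
    assume le: "G \<le> X'"
    have X': "X' = num_game (x - ulp x)"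
      using that x(1) by (auto simp: lopts_num split: if_splits)
    have "\<not> fits G (x - ulp x)"
      using min[of "x - ulp x"] size_lopts[OF that] x(1) unfolding X' by auto
    then consider G' where "G' |\<in>| lopts G" "X' \<le> G'" | G' where "G' |\<in>| ropts G" "G' \<le> X'"
      unfolding fits_def X' by blast
    then show False
    proof cases
      case 1
      then show False
        using not_ge_lopt[OF 1(1)] order_trans[OF le 1(2)] by blast
    next
      case 2
      have "X' \<le> num_game x"
        using x(1) ulp_pos[of x] unfolding X' by (simp add: num_le_iff less_imp_le)
      then show False
        using 2 x(2) order_trans[of G' X' "num_game x"] unfolding fits_def by blast
    qed
  qed
  have "G \<le> num_game x"
    using 1 x(2) by (subst game_le_iff) (simp add: fits_def)
  moreover have "num_game x \<le> G"
    using 2 x(2) by (subst game_le_iff) (simp add: fits_def)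
  ultimately show ?thesis by (simp add: game_eq_def)
qed

lemma fits_obtains_simplest:
  assumes "x \<in> dyadics" "fits G x"
  obtains y where "y \<in> dyadics" "fits G y" "\<And>z. z \<in> dyadics \<Longrightarrow> fits G z \<Longrightarrow> size (num_game y) \<le> size (num_game z)"
  using ex_has_least_nat[of "\<lambda>x. x \<in> dyadics \<and> fits G x" x "\<lambda>x. size (num_game x)"] assms by blast

lemma fits_imp_number:
  assumes "x \<in> dyadics" "fits G x"
  shows "\<exists>y. has_value G y"
proof -
  obtain y where y: "y \<in> dyadics" "fits G y"
    and min: "\<And>z. z \<in> dyadics \<Longrightarrow> fits G z \<Longrightarrow> size (num_game y) \<le> size (num_game z)"
    using assms by (rule fits_obtains_simplest) blast
  then have "has_value G y"
    unfolding has_value_def by (simp add: simplest_fit)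
  then show ?thesis ..
qed

text \<open>Without Left options, fitting is inherited by smaller numbers. A non-integer x has the
  simpler Left option x - \<open>ulp x\<close>, so the simplest fitting number is an
  integer.\<close>

lemma no_lopts_imp_integer:
  assumes "lopts G = {||}"
  shows "\<exists>n. G \<approx> int_game n"
proof -
  obtain n where n: "- G \<le> num_game (of_nat n)" by (rule game_bounded_above)
  \<comment> \<open>A Right option \<le> -n would be \<le> \<open>G\<close>, since -n \<le>
    \<open>G\<close>.\<close>
  have "fits G (- of_nat n)"
    unfolding fits_def
  proof (intro conjI allI impI notI)
    fix G' assume G': "G' |\<in>| ropts G" "G' \<le> num_game (- of_nat n)"
    have "num_game (- of_nat n) \<le> G"
      using n dyadics_of_int[of "int n"] by (simp add: num_neg game_neg_le_iff')
    then show False using not_ropt_le[OF G'(1)] order_trans[OF G'(2)] by blast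
  qed (simp add: assms)
  then obtain x where x: "x \<in> dyadics" "fits G x"
    and min: "\<And>z. z \<in> dyadics \<Longrightarrow> fits G z \<Longrightarrow> size (num_game x) \<le> size (num_game z)"
    using fits_obtains_simplest[of "- of_nat n" G] dyadics_of_int[of "- int n"] by auto
  have "x \<in> \<int>"
  proof (rule ccontr)
    assume "x \<notin> \<int>"
    then have "num_game (x - ulp x) |\<in>| lopts (num_game x)"
      using x by (simp add: lopts_num)
    then have "\<not> fits G (x - ulp x)"
      using min[of "x - ulp x"] size_lopts[of "num_game (x - ulp x)" "num_game x"] x by auto
    then obtain G' where "G' |\<in>| ropts G" "G' \<le> num_game (x - ulp x)"
      unfolding fits_def using assms by auto
    moreover have "num_game (x - ulp x) \<le> num_game x"
      using x ulp_pos[of x] by (simp add: num_le_iff less_imp_le)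
    ultimately show False
      using x(2) order_trans[of G' "num_game (x - ulp x)" "num_game x"] unfolding fits_def by blast
  qed
  then obtain m where "x = of_int m" by (auto elim: Ints_cases)
  moreover have "G \<approx> num_game x"
    using x min by (rule simplest_fit)
  ultimately show ?thesis by (auto simp: num_int)
qed

lemma int_game_neg: "int_game (- n) = - int_game n"
  using num_neg[of "of_int n"] by (simp flip: num_int)

lemma no_ropts_imp_integer:
  assumes "ropts G = {||}"
  shows "\<exists>n. G \<approx> int_game n"
proof -
  obtain n where "- G \<approx> int_game n"
    using no_lopts_imp_integer[of "- G"] assms by (auto simp: lopts_neg)
  then have "G \<approx> int_game (- n)"
    using game_eq_neg_iff[of "- G" "int_game n"] by (simp add: int_game_neg)
  then show ?thesis ..
qed

text \<open>A weak form of number avoidance: climb from \<open>y\<close> through Right options of numbers.\<close>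

lemma number_avoidance:
  assumes "S \<subseteq> dyadics" "\<And>x. x \<in> S \<Longrightarrow> x + ulp x \<in> S" "\<And>x. x \<in> S \<Longrightarrow> \<not> G \<approx> num_game x"
    and "y \<in> S" "num_game y \<le> G"
  shows "\<exists>G'. G' |\<in>| lopts G \<and> num_game y \<le> G'"
  using assms(4,5)
proof (induction "size (num_game y)" arbitrary: y rule: less_induct)
  case less
  have y: "y \<in> dyadics" using less.prems assms(1) by auto
  have "\<not> G \<le> num_game y"
    using less.prems assms(3) by (auto simp: game_eq_def)
  then consider "\<exists>G'. G' |\<in>| lopts G \<and> num_game y \<le> G'" | Y where "Y |\<in>| ropts (num_game y)" "Y \<le> G"
    unfolding game_le_iff[of G] by blast
  then show ?case
  proof cases
    case 2
    then have Y: "Y = num_game (y + ulp y)"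
      using y by (auto simp: ropts_num split: if_splits)
    obtain G' where "G' |\<in>| lopts G" "Y \<le> G'"
      using less.hyps[of "y + ulp y"] 2 size_ropts[OF 2(1)] assms(2)[OF less.prems(1)] unfolding Y by auto
    moreover have "num_game y \<le> Y"
      using y ulp_pos[of y] unfolding Y by (simp add: num_le_iff less_imp_le)
    ultimately have "num_game y \<le> G'" by (metis order_trans)
    with \<open>G' |\<in>| lopts G\<close> show ?thesis by blast
  qed
qed

lemma number_avoidance_dyadic:
  "\<nexists>x. has_value G x \<Longrightarrow> y \<in> dyadics \<Longrightarrow> num_game y \<le> G \<Longrightarrow> \<exists>G'. G' |\<in>| lopts G \<and> num_game y \<le> G'"
  by (rule number_avoidance[of dyadics]) (auto simp: has_value_def)

text \<open>Here \<open>G\<close> may still be a number, as long as it is not an integer; cooling by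
  -1 needs this case.\<close>

lemma number_avoidance_int:
  assumes "\<nexists>n. G \<approx> int_game n" "int_game n \<le> G"
  shows "\<exists>G'. G' |\<in>| lopts G \<and> int_game n \<le> G'"
proof -
  have "ulp x = 1" if "x \<in> \<int>" for x
    using that den_eq_0_iff[of x] by (auto simp: ulp_def elim!: Ints_cases)
  moreover have "\<not> G \<approx> num_game x" if "x \<in> \<int>" for x
    using that assms(1) by (auto simp: num_int elim!: Ints_cases)
  moreover have "\<int> \<subseteq> dyadics"
    by (auto elim!: Ints_cases)
  ultimately show ?thesis
    using number_avoidance[of "\<int>" G "of_int n"] assms(2) by (simp add: num_int)
qed

section \<open>Stops and the order\<close>

lemma has_value_unique: "has_value G x \<Longrightarrow> has_value G y \<Longrightarrow> x = y"
  using num_le_iff[of x y] num_le_iff[of y x] order_trans[of "num_game x" G "num_game y"]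
    order_trans[of "num_game y" G "num_game x"]
  unfolding has_value_def game_eq_def by simp

lemma has_value_neg: "has_value G x \<Longrightarrow> has_value (- G) (- x)"
  unfolding has_value_def by (simp add: num_neg game_eq_neg_iff)

lemma has_value_neg_iff: "has_value (- G) x \<longleftrightarrow> has_value G (- x)"
  using has_value_neg[of G "- x"] has_value_neg[of "- G" x] by auto

lemma stops_value:
  assumes "has_value G x"
  shows "left_stop G = x" "right_stop G = x"
proof -
  have "(THE x. has_value G x) = x"
    using assms by (rule the_equality) (rule has_value_unique[OF _ assms])
  then show "left_stop G = x" "right_stop G = x"
    unfolding left_stop.simps[of G] right_stop.simps[of G] using assms by auto
qed

lemma stops_no_value:
  assumes "\<nexists>x. has_value G x"
  shows "left_stop G = Max (right_stop ` fset (lopts G))" "right_stop G = Min (left_stop ` fset (ropts G))"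
  unfolding left_stop.simps[of G] right_stop.simps[of G] using assms by auto

lemma has_value_int: "G \<approx> int_game n \<Longrightarrow> has_value G (of_int n)"
  by (simp add: has_value_def num_int)

lemma no_value_options_nonempty:
  assumes "\<nexists>x. has_value G x"
  shows "lopts G \<noteq> {||}" "ropts G \<noteq> {||}"
  using assms no_lopts_imp_integer no_ropts_imp_integer has_value_int by blast+

lemma stops_neg: "left_stop (- G) = - right_stop G \<and> right_stop (- G) = - left_stop G"
proof (induction "size G" arbitrary: G rule: less_induct)
  case less
  show ?case
  proof (cases "\<exists>x. has_value G x")
    case True
    then show ?thesis using stops_value has_value_neg by metis
  next
    case False
    then have "\<nexists>x. has_value (- G) x" by (simp add: has_value_neg_iff)
    note eqs = stops_no_value[OF this] stops_no_value[OF False]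
    have "right_stop ` fset (lopts (- G)) = uminus ` left_stop ` fset (ropts G)"
      "left_stop ` fset (ropts (- G)) = uminus ` right_stop ` fset (lopts G)"
      unfolding lopts_neg ropts_neg fimage.rep_eq image_image
      using less by (auto intro!: image_cong simp: size_lopts size_ropts)
    then show ?thesis
      unfolding eqs using no_value_options_nonempty[OF False]
      by (simp add: fset_eq_empty_iff)
  qed
qed

lemma left_stop_neg: "left_stop (- G) = - right_stop G" and right_stop_neg: "right_stop (- G) = - left_stop G"
  using stops_neg[of G] by auto

text \<open>Nothing is claimed about \<open>G \<le> num_game x\<close> at x = LS(G), since the stops
  do not decide it: 0 and * have the same stops, but * \<le> 0 fails. The induction is on
  \<open>nsize\<close> because right stops of Left options are read off as left stops of their
  negatives.\<close>

lemma left_stop_aux: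
  "left_stop G \<in> dyadics \<and>
   (\<forall>x\<in>dyadics. (G \<le> num_game x \<longrightarrow> left_stop G \<le> x) \<and> (left_stop G < x \<longrightarrow> G \<le> num_game x))"
proof (induction "nsize G" arbitrary: G rule: less_induct)
  case less
  show ?case
  proof (cases "\<exists>y. has_value G y")
    case True
    then obtain y where y: "y \<in> dyadics" "G \<approx> num_game y" "left_stop G = y"
      using stops_value(1) unfolding has_value_def by blast
    have "G \<le> num_game x \<longleftrightarrow> y \<le> x" if "x \<in> dyadics" for x
      using num_le_iff[OF y(1) that] y(2) order_trans unfolding game_eq_def by blast
    with y show ?thesis by auto
  next
    case False
    have IH: "right_stop G' \<in> dyadics" "x \<in> dyadics \<Longrightarrow> num_game x \<le> G' \<Longrightarrow> x \<le> right_stop G'"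
      "x \<in> dyadics \<Longrightarrow> x < right_stop G' \<Longrightarrow> num_game x \<le> G'" if "G' |\<in>| lopts G" for G' x
    proof -
      note * = less[of "- G'", unfolded nsize_neg, OF nsize_lopts[OF that]]
      show "right_stop G' \<in> dyadics"
        using * by (simp add: left_stop_neg)
      assume x: "x \<in> dyadics"
      then have "(- G' \<le> num_game (- x) \<longrightarrow> left_stop (- G') \<le> - x) \<and> (left_stop (- G') < - x \<longrightarrow> - G' \<le> num_game (- x))"
        using * by simp
      with x show "num_game x \<le> G' \<Longrightarrow> x \<le> right_stop G'" "x < right_stop G' \<Longrightarrow> num_game x \<le> G'"
        by (simp_all add: left_stop_neg num_neg game_neg_le_iff)
    qed
    let ?A = "right_stop ` fset (lopts G)"
    have A: "finite ?A" "?A \<noteq> {}"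
      using no_value_options_nonempty(1)[OF False] by (auto simp: fset_eq_empty_iff)
    have L: "left_stop G = Max ?A" by (rule stops_no_value[OF False])
    have "left_stop G \<in> ?A" unfolding L using A by (rule Max_in)
    then have "left_stop G \<in> dyadics" using IH(1) by auto
    moreover have "left_stop G \<le> x" if "x \<in> dyadics" "G \<le> num_game x" for x
    proof -
      have "right_stop G' \<le> x" if G': "G' |\<in>| lopts G" for G'
        using IH(3)[OF G' \<open>x \<in> dyadics\<close>] order_trans[OF \<open>G \<le> num_game x\<close>] not_ge_lopt[OF G']
        by (metis not_le)
      then show ?thesis unfolding L using A by (auto simp: Max_le_iff)
    qed
    moreover have "G \<le> num_game x" if x: "x \<in> dyadics" "left_stop G < x" for x
    proof (subst game_le_iff, intro conjI allI impI notI)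
      have *: "\<not> num_game x \<le> G'" if G': "G' |\<in>| lopts G" for G'
        using IH(2)[OF G' x(1)] x(2) G' A unfolding L by (auto simp: Max_less_iff)
      fix G' assume "G' |\<in>| lopts G" "num_game x \<le> G'"
      with * show False by auto
    next
      fix X assume X: "X |\<in>| ropts (num_game x)" "X \<le> G"
      then have X': "X = num_game (x + ulp x)"
        using x by (auto simp: ropts_num split: if_splits)
      \<comment> \<open>The Right option of x exceeds LS(G) as well; number avoidance produces a
        Left option of \<open>G\<close> above it, whose right stop is then too large.\<close>
      then obtain G' where G': "G' |\<in>| lopts G" "X \<le> G'"
        using number_avoidance_dyadic[OF False, of "x + ulp x"] X x by auto
      have "x + ulp x \<le> right_stop G'"
        using IH(2)[OF G'(1), of "x + ulp x"] G'(2) x unfolding X' by auto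
      also have "right_stop G' \<le> left_stop G"
        unfolding L using A G' by auto
      finally show False using x ulp_pos[of x] by simp
    qed
    ultimately show ?thesis by blast
  qed
qed

lemma left_stop_dyadics [simp]: "left_stop G \<in> dyadics"
  and left_stop_le: "x \<in> dyadics \<Longrightarrow> G \<le> num_game x \<Longrightarrow> left_stop G \<le> x"
  and le_if_left_stop_less: "x \<in> dyadics \<Longrightarrow> left_stop G < x \<Longrightarrow> G \<le> num_game x"
  using left_stop_aux[of G] by auto

lemma le_right_stop: "x \<in> dyadics \<Longrightarrow> num_game x \<le> G \<Longrightarrow> x \<le> right_stop G"
  using left_stop_le[of "- x" "- G"] by (simp add: left_stop_neg num_neg game_neg_le_iff)

lemma ge_if_less_right_stop: "x \<in> dyadics \<Longrightarrow> x < right_stop G \<Longrightarrow> num_game x \<le> G"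
  using le_if_left_stop_less[of "- x" "- G"] by (simp add: left_stop_neg num_neg game_neg_le_iff)

lemma right_stop_le_left_stop: "right_stop G \<le> left_stop G"
proof (rule ccontr)
  assume "\<not> right_stop G \<le> left_stop G"
  then have "left_stop G < right_stop G" by simp
  then obtain x where x: "x \<in> dyadics" "left_stop G < x" "x < right_stop G"
    by (rule dyadics_dense)
  obtain y where y: "y \<in> dyadics" "x < y" "y < right_stop G"
    using dyadics_dense[OF x(3)] .
  have "num_game y \<le> G" "G \<le> num_game x"
    using x y by (simp_all add: ge_if_less_right_stop le_if_left_stop_less)
  then have "num_game y \<le> num_game x" by (rule order_trans)
  with x y show False by (simp add: num_le_iff)
qed

lemma left_stop_add_le:
  assumes "x \<in> dyadics"
  shows "left_stop (G + num_game x) \<le> left_stop G + x"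
proof (rule ccontr)
  assume "\<not> ?thesis"
  then have "left_stop G + x < left_stop (G + num_game x)" by simp
  then obtain y where y: "y \<in> dyadics" "left_stop G + x < y" "y < left_stop (G + num_game x)"
    by (rule dyadics_dense)
  have "G \<le> num_game (y - x)"
    using y assms by (intro le_if_left_stop_less) auto
  then have "G + num_game x \<le> num_game (y - x) + num_game x"
    by (simp add: game_add_le_cancel)
  also have "\<dots> \<le> num_game y"
    using num_add[of "y - x" x] y assms by (simp add: game_eq_def)
  finally show False
    using left_stop_le[OF y(1)] y by fastforce
qed

lemma left_stop_mono:
  assumes "G \<le> H"
  shows "left_stop G \<le> left_stop H"
proof (rule ccontr)
  assume "\<not> left_stop G \<le> left_stop H"
  then have "left_stop H < left_stop G" by simp
  then obtain y where y: "y \<in> dyadics" "left_stop H < y" "y < left_stop G"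
    by (rule dyadics_dense)
  then have "G \<le> num_game y" using le_if_left_stop_less assms order_trans by blast
  then show False using left_stop_le y by fastforce
qed

lemma left_stop_add:
  assumes "x \<in> dyadics"
  shows "left_stop (G + num_game x) = left_stop G + x"
proof -
  have "G \<le> G + (num_game x + num_game (- x))"
    using num_add[of x "- x"] assms game_add_le_cancel[of 0 G "num_game x + num_game (- x)"]
    by (simp add: game_eq_def add.commute)
  then have "left_stop G \<le> left_stop (G + num_game x + num_game (- x))"
    by (simp add: left_stop_mono add.assoc)
  also have "\<dots> \<le> left_stop (G + num_game x) - x"
    using left_stop_add_le[of "- x" "G + num_game x"] assms by simp
  finally show ?thesis using left_stop_add_le[OF assms, of G] by simp
qed

lemma right_stop_add:
  assumes "x \<in> dyadics"
  shows "right_stop (G + num_game x) = right_stop G + x"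
  using left_stop_add[of "- x" "- G"] left_stop_neg[of "G + num_game x"] left_stop_neg[of G] assms
  by (simp add: num_neg game_neg_add)

lemma left_stop_diff: "x \<in> dyadics \<Longrightarrow> left_stop (G - num_game x) = left_stop G - x"
  and right_stop_diff: "x \<in> dyadics \<Longrightarrow> right_stop (G - num_game x) = right_stop G - x"
  using left_stop_add[of "- x" G] right_stop_add[of "- x" G] by (simp_all add: minus_game_def num_neg)

lemma stops_num: "x \<in> dyadics \<Longrightarrow> left_stop (num_game x) = x" "x \<in> dyadics \<Longrightarrow> right_stop (num_game x) = x"
  using stops_value[of "num_game x" x] by (auto simp: has_value_def)

text \<open>Subtracting x shifts both stops by x, so being infinitesimally close to a number means
  that the stops coincide; they are dyadic anyway.\<close>

lemma close_to_number_iff: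
  "close_to_number K x \<longleftrightarrow> left_stop K = x \<and> right_stop K = x"
  unfolding close_to_number_def inf_close_def infinitesimal_def
  using left_stop_dyadics[of K] by (auto simp: left_stop_diff right_stop_diff)

lemma ex_close_to_number_iff: "(\<exists>x. close_to_number K x) \<longleftrightarrow> left_stop K = right_stop K"
  by (auto simp: close_to_number_iff)

text \<open>Lets the recursion for the stops be used without knowing whether \<open>K\<close> is a
  number: the value y of a number satisfies Max \<le> y \<le> Min, and the assumed Min \<le> Max
  makes all three equal.\<close>

lemma stops_eq_Max_Min:
  assumes "lopts K \<noteq> {||}" "ropts K \<noteq> {||}"
    and "Min (left_stop ` fset (ropts K)) \<le> Max (right_stop ` fset (lopts K))"
  shows "left_stop K = Max (right_stop ` fset (lopts K))" "right_stop K = Min (left_stop ` fset (ropts K))"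
proof -
  let ?a = "Max (right_stop ` fset (lopts K))" and ?b = "Min (left_stop ` fset (ropts K))"
  have "left_stop K = ?a \<and> right_stop K = ?b"
  proof (cases "\<exists>x. has_value K x")
    case True
    then obtain y where y: "has_value K y" ..
    then have yd: "y \<in> dyadics" and eq: "K \<approx> num_game y" by (auto simp: has_value_def)
    have "right_stop G' \<le> y" if "G' |\<in>| lopts K" for G'
      using ge_if_less_right_stop[OF yd, of G'] not_ge_lopt[OF that] eq order_trans[of K "num_game y" G']
      unfolding game_eq_def by (metis not_le)
    then have "?a \<le> y" using assms(1) by (simp add: fset_eq_empty_iff)
    have "y \<le> left_stop G'" if "G' |\<in>| ropts K" for G'
      using le_if_left_stop_less[OF yd, of G'] not_ropt_le[OF that] eq order_trans[of G' "num_game y" K]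
      unfolding game_eq_def by (metis not_le)
    then have "y \<le> ?b" using assms(2) by (simp add: fset_eq_empty_iff)
    with \<open>?a \<le> y\<close> assms(3) stops_value[OF y] show ?thesis by simp
  qed (simp add: stops_no_value)
  then show "left_stop K = ?a" "right_stop K = ?b" by auto
qed

text \<open>The complementary case: a dyadic strictly inside the gap fits.\<close>

lemma number_if_Max_less_Min:
  assumes "lopts K \<noteq> {||}" "ropts K \<noteq> {||}"
    and "Max (right_stop ` fset (lopts K)) < Min (left_stop ` fset (ropts K))"
  shows "\<exists>x. has_value K x"
proof -
  obtain x where x: "x \<in> dyadics" "Max (right_stop ` fset (lopts K)) < x" "x < Min (left_stop ` fset (ropts K))"
    using dyadics_dense[OF assms(3)] .
  have "\<not> num_game x \<le> G'" if "G' |\<in>| lopts K" for G'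
    using x that assms(1) le_right_stop[OF x(1), of G'] by (auto simp: fset_eq_empty_iff)
  moreover have "\<not> G' \<le> num_game x" if "G' |\<in>| ropts K" for G'
    using x that assms(2) left_stop_le[OF x(1), of G'] by (auto simp: fset_eq_empty_iff)
  ultimately have "fits K x" by (simp add: fits_def)
  with x(1) show ?thesis by (rule fits_imp_number)
qed

section \<open>Functions that are piecewise linear on a dyadic grid\<close>

text \<open>Left walls of thermographs and negated Right walls are of this kind, which makes the \<open>LEAST\<close> in the
  definitions of cooling and temperature exist: an infimum of dyadics need not be dyadic.\<close>

definition grid :: "nat \<Rightarrow> (real \<Rightarrow> real) \<Rightarrow> bool" where
  "grid N f \<longleftrightarrow> (\<forall>k::int. - (2 ^ N :: int) \<le> k \<longrightarrow> f (k / 2 ^ N) * 2 ^ N \<in> \<int> \<and>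
     (\<exists>s\<in>{0, -1}. \<forall>u\<in>dyadics. 0 \<le> u \<longrightarrow> u \<le> 1 / 2 ^ N \<longrightarrow> f (k / 2 ^ N + u) = f (k / 2 ^ N) + s * u))"

lemma gridD:
  fixes k :: int
  assumes "grid N f" "- (2 ^ N :: int) \<le> k"
  obtains s where "f (k / 2 ^ N) * 2 ^ N \<in> \<int>" "s = 0 \<or> s = -1"
    "\<And>u. u \<in> dyadics \<Longrightarrow> 0 \<le> u \<Longrightarrow> u \<le> 1 / 2 ^ N \<Longrightarrow> f (k / 2 ^ N + u) = f (k / 2 ^ N) + s * u"
proof -
  have *: "f (k / 2 ^ N) * 2 ^ N \<in> \<int>" and "\<exists>s\<in>{0, -1}. \<forall>u\<in>dyadics. 0 \<le> u \<longrightarrow> u \<le> 1 / 2 ^ N \<longrightarrow>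
      f (k / 2 ^ N + u) = f (k / 2 ^ N) + s * u"
    using assms unfolding grid_def by blast+
  then obtain s where "s \<in> {0, -1}" "\<forall>u\<in>dyadics. 0 \<le> u \<longrightarrow> u \<le> 1 / 2 ^ N \<longrightarrow>
      f (k / 2 ^ N + u) = f (k / 2 ^ N) + s * u"
    by blast
  with * show ?thesis by (intro that[of s]) simp_all
qed

lemma cooling_paramsI: "t \<in> dyadics \<Longrightarrow> -1 \<le> t \<Longrightarrow> t \<in> cooling_params"
  and cooling_paramsD: "t \<in> cooling_params \<Longrightarrow> t \<in> dyadics" "t \<in> cooling_params \<Longrightarrow> -1 \<le> t"
  by (simp_all add: cooling_params_def)

lemma grid_point_params: "- (2 ^ N :: int) \<le> k \<Longrightarrow> of_int k / 2 ^ N \<in> cooling_params"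
proof (rule cooling_paramsI[OF dyadicsI[OF refl]])
  assume "- (2 ^ N :: int) \<le> k"
  then have "real_of_int (- (2 ^ N)) \<le> real_of_int k" by (simp only: of_int_le_iff)
  then show "- 1 \<le> real_of_int k / 2 ^ N" by (simp add: field_simps)
qed

text \<open>A grid statement reads a function only at dyadics \<ge> -1, the temperatures at which
  the stops of \<open>cool G t\<close> are controlled.\<close>

lemma grid_cong:
  assumes "\<And>t. t \<in> cooling_params \<Longrightarrow> f t = g t" "grid N f"
  shows "grid N g"
  unfolding grid_def
proof (intro allI impI)
  fix k :: int assume k: "- (2 ^ N :: int) \<le> k"
  obtain s where s: "f (k / 2 ^ N) * 2 ^ N \<in> \<int>" "s = 0 \<or> s = -1"
    "\<And>u. u \<in> dyadics \<Longrightarrow> 0 \<le> u \<Longrightarrow> u \<le> 1 / 2 ^ N \<Longrightarrow> f (k / 2 ^ N + u) = f (k / 2 ^ N) + s * u"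
    using gridD[OF assms(2) k] by metis
  have "g (k / 2 ^ N) = f (k / 2 ^ N)"
    using assms(1)[OF grid_point_params[OF k]] by simp
  moreover have "g (k / 2 ^ N + u) = f (k / 2 ^ N + u)" if "u \<in> dyadics" "0 \<le> u" for u
    using assms(1)[of "k / 2 ^ N + u"] that cooling_paramsD[OF grid_point_params[OF k]]
    by (simp add: cooling_paramsI)
  ultimately show "g (k / 2 ^ N) * 2 ^ N \<in> \<int> \<and>
     (\<exists>s\<in>{0, -1}. \<forall>u\<in>dyadics. 0 \<le> u \<longrightarrow> u \<le> 1 / 2 ^ N \<longrightarrow> g (k / 2 ^ N + u) = g (k / 2 ^ N) + s * u)"
    using s by (intro conjI bexI[of _ s]) auto
qed

lemma grid_const: "c * 2 ^ N \<in> \<int> \<Longrightarrow> grid N (\<lambda>_. c)"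
  unfolding grid_def by auto

lemma grid_refine_Suc:
  assumes "grid N f"
  shows "grid (Suc N) f"
  unfolding grid_def
proof (intro allI impI)
  fix k :: int assume k: "- (2 ^ Suc N :: int) \<le> k"
  define j where "j = k div 2"
  define r where "r = k mod 2"
  have kj: "k = 2 * j + r" and r: "r = 0 \<or> r = 1" unfolding j_def r_def by auto
  have j: "- (2 ^ N :: int) \<le> j" using k unfolding j_def by simp
  obtain s where s: "f (j / 2 ^ N) * 2 ^ N \<in> \<int>" "s = 0 \<or> s = -1"
    "\<And>u. u \<in> dyadics \<Longrightarrow> 0 \<le> u \<Longrightarrow> u \<le> 1 / 2 ^ N \<Longrightarrow> f (j / 2 ^ N + u) = f (j / 2 ^ N) + s * u"
    using gridD[OF assms j] by metis
  define h where "h = r / 2 ^ Suc N"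
  have h: "h \<in> dyadics" "0 \<le> h" "h \<le> 1 / 2 ^ Suc N"
    using r unfolding h_def by (auto simp: field_simps intro: dyadicsI[of _ r "Suc N"])
  have eq: "k / 2 ^ Suc N = j / 2 ^ N + h"
    unfolding h_def kj by (simp add: field_simps)
  have half: "1 / 2 ^ Suc N + 1 / 2 ^ Suc N = (1 / 2 ^ N :: real)" by simp
  have val: "f (k / 2 ^ Suc N) = f (j / 2 ^ N) + s * h"
    unfolding eq using s(3)[of h] h half by linarith
  have "f (k / 2 ^ Suc N) * 2 ^ Suc N = 2 * (f (j / 2 ^ N) * 2 ^ N) + s * r"
    unfolding val h_def by (simp add: field_simps)
  also have "\<dots> \<in> \<int>" using s(1,2) r by (auto intro!: Ints_add Ints_mult Ints_diff)
  finally have "f (k / 2 ^ Suc N) * 2 ^ Suc N \<in> \<int>" .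
  moreover have "f (k / 2 ^ Suc N + u) = f (k / 2 ^ Suc N) + s * u"
    if "u \<in> dyadics" "0 \<le> u" "u \<le> 1 / 2 ^ Suc N" for u
  proof -
    have "h + u \<le> 1 / 2 ^ N" using h(3) that(3) half by linarith
    then have "f (j / 2 ^ N + (h + u)) = f (j / 2 ^ N) + s * (h + u)"
      using s(3)[of "h + u"] h that by simp
    then show ?thesis unfolding val unfolding eq by (simp add: algebra_simps)
  qed
  ultimately show "f (k / 2 ^ Suc N) * 2 ^ Suc N \<in> \<int> \<and>
     (\<exists>s\<in>{0, -1}. \<forall>u\<in>dyadics. 0 \<le> u \<longrightarrow> u \<le> 1 / 2 ^ Suc N \<longrightarrow> f (k / 2 ^ Suc N + u) = f (k / 2 ^ Suc N) + s * u)"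
    using s(2) by (intro conjI bexI[of _ s]) auto
qed

lemma grid_refine: "N \<le> M \<Longrightarrow> grid N f \<Longrightarrow> grid M f"
  by (induction M rule: dec_induct) (simp_all add: grid_refine_Suc)

text \<open>Exchanges the slopes 0 and -1. With f the negated right stop of a Left option, the
  result is RS - t, the contribution of that option to the left wall; the right wall is treated
  alike.\<close>

lemma grid_flip:
  assumes "grid N f"
  shows "grid N (\<lambda>t. - f t - t)"
  unfolding grid_def
proof (intro allI impI)
  fix k :: int assume k: "- (2 ^ N :: int) \<le> k"
  obtain s where s: "f (k / 2 ^ N) * 2 ^ N \<in> \<int>" "s = 0 \<or> s = -1"
    "\<And>u. u \<in> dyadics \<Longrightarrow> 0 \<le> u \<Longrightarrow> u \<le> 1 / 2 ^ N \<Longrightarrow> f (k / 2 ^ N + u) = f (k / 2 ^ N) + s * u"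
    using gridD[OF assms k] by metis
  have "(- f (k / 2 ^ N) - k / 2 ^ N) * 2 ^ N = - (f (k / 2 ^ N) * 2 ^ N) - k"
    by (simp add: field_simps)
  also have "\<dots> \<in> \<int>" using s(1) by (intro Ints_diff Ints_minus) auto
  finally show "(- f (k / 2 ^ N) - k / 2 ^ N) * 2 ^ N \<in> \<int> \<and>
     (\<exists>s\<in>{0, -1}. \<forall>u\<in>dyadics. 0 \<le> u \<longrightarrow> u \<le> 1 / 2 ^ N \<longrightarrow>
        - f (k / 2 ^ N + u) - (k / 2 ^ N + u) = - f (k / 2 ^ N) - k / 2 ^ N + s * u)"
    using s(2,3) by (intro conjI bexI[of _ "- s - 1"]) (auto simp: algebra_simps)
qed

text \<open>On a cell, the difference of two such functions changes by at most one grid unit, so it cannot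
  change sign inside the cell.\<close>

lemma grid_max:
  assumes "grid N f" "grid N g"
  shows "grid N (\<lambda>t. max (f t) (g t))"
  unfolding grid_def
proof (intro allI impI)
  fix k :: int assume k: "- (2 ^ N :: int) \<le> k"
  obtain s where s: "f (k / 2 ^ N) * 2 ^ N \<in> \<int>" "s = 0 \<or> s = -1"
    "\<And>u. u \<in> dyadics \<Longrightarrow> 0 \<le> u \<Longrightarrow> u \<le> 1 / 2 ^ N \<Longrightarrow> f (k / 2 ^ N + u) = f (k / 2 ^ N) + s * u"
    using gridD[OF assms(1) k] by metis
  obtain r where r: "g (k / 2 ^ N) * 2 ^ N \<in> \<int>" "r = 0 \<or> r = -1"
    "\<And>u. u \<in> dyadics \<Longrightarrow> 0 \<le> u \<Longrightarrow> u \<le> 1 / 2 ^ N \<Longrightarrow> g (k / 2 ^ N + u) = g (k / 2 ^ N) + r * u"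
    using gridD[OF assms(2) k] by metis
  obtain a b :: int where ab: "f (k / 2 ^ N) * 2 ^ N = a" "g (k / 2 ^ N) * 2 ^ N = b"
    using s(1) r(1) by (metis Ints_cases)
  then have ab': "f (k / 2 ^ N) = a / 2 ^ N" "g (k / 2 ^ N) = b / 2 ^ N"
    by (simp_all add: field_simps)
  have gap: "real_of_int m / 2 ^ N + 1 / 2 ^ N \<le> n / 2 ^ N" if "m < n" for m n :: int
  proof -
    have "real_of_int m + 1 \<le> n" using that by linarith
    then show ?thesis by (simp add: divide_right_mono flip: add_divide_distrib)
  qed
  have max: "max (f (k / 2 ^ N)) (g (k / 2 ^ N)) * 2 ^ N \<in> \<int>"
    using s(1) r(1) by (simp add: max_def)
  \<comment> \<open>The function that is larger at the left end of the cell keeps its slope; on a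
    tie the flatter one wins.\<close>
  define q where "q = (if a < b then r else if b < a then s else max r s)"
  have "max (f (k / 2 ^ N + u)) (g (k / 2 ^ N + u)) = max (f (k / 2 ^ N)) (g (k / 2 ^ N)) + q * u"
    if u: "u \<in> dyadics" "0 \<le> u" "u \<le> 1 / 2 ^ N" for u
  proof -
    have su: "s * u \<le> 0" "- u \<le> s * u" "r * u \<le> 0" "- u \<le> r * u"
      using s(2) r(2) u(2) by auto
    consider "a < b" | "a = b" | "b < a" by linarith
    then show ?thesis
    proof cases
      case 1
      with gap[OF 1] su u(3) show ?thesis
        unfolding s(3)[OF u] r(3)[OF u] ab' q_def by (simp add: max_def)
    next
      case 2
      have "max (s * u) (r * u) = max r s * u"
        using s(2) r(2) u(2) by (auto simp: max_def)
      with 2 show ?thesis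
        unfolding s(3)[OF u] r(3)[OF u] ab' q_def by (simp add: max_add_distrib_right)
    next
      case 3
      with gap[OF 3] su u(3) show ?thesis
        unfolding s(3)[OF u] r(3)[OF u] ab' q_def by (simp add: max_def)
    qed
  qed
  moreover have "q \<in> {0, -1}" using s(2) r(2) unfolding q_def by auto
  ultimately show "max (f (k / 2 ^ N)) (g (k / 2 ^ N)) * 2 ^ N \<in> \<int> \<and>
     (\<exists>s\<in>{0, -1}. \<forall>u\<in>dyadics. 0 \<le> u \<longrightarrow> u \<le> 1 / 2 ^ N \<longrightarrow>
        max (f (k / 2 ^ N + u)) (g (k / 2 ^ N + u)) = max (f (k / 2 ^ N)) (g (k / 2 ^ N)) + s * u)"
    using max by blast
qed

lemma grid_Max:
  assumes "finite A" "A \<noteq> {}" "\<And>x. x \<in> A \<Longrightarrow> grid N (f x)"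
  shows "grid N (\<lambda>t. Max ((\<lambda>x. f x t) ` A))"
  using assms
proof (induction A rule: finite_ne_induct)
  case (insert x A)
  then have "grid N (\<lambda>t. max (f x t) (Max ((\<lambda>x. f x t) ` A)))"
    by (intro grid_max) auto
  with insert.hyps show ?case by simp
qed simp

text \<open>The shape of a wall with its mast: follow \<open>f\<close> up to the temperature s, then
  stay vertical. As s is a grid point, no cell is split.\<close>

lemma grid_freeze:
  assumes f: "grid N f" and s: "s * 2 ^ N \<in> \<int>" "-1 \<le> s"
  shows "grid N (\<lambda>t. if t \<le> s then f t else f s)"
proof -
  obtain m :: int where "s * 2 ^ N = m" using s(1) by (auto elim: Ints_cases)
  then have m: "s = m / 2 ^ N" by (simp add: field_simps)
  then have "real_of_int (- (2 ^ N)) \<le> real_of_int m"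
    using mult_right_mono[OF s(2), of "2 ^ N"] by simp
  then have m_ge: "- (2 ^ N :: int) \<le> m" by (simp only: of_int_le_iff)
  define h where "h t = (if t \<le> s then f t else f s)" for t
  have "grid N h"
    unfolding grid_def
  proof (intro allI impI)
    fix k :: int assume k: "- (2 ^ N :: int) \<le> k"
    show "h (k / 2 ^ N) * 2 ^ N \<in> \<int> \<and>
       (\<exists>s\<in>{0, -1}. \<forall>u\<in>dyadics. 0 \<le> u \<longrightarrow> u \<le> 1 / 2 ^ N \<longrightarrow> h (k / 2 ^ N + u) = h (k / 2 ^ N) + s * u)"
    proof (cases "k < m")
      case True
      have "real_of_int k + 1 \<le> m" using True by linarith
      then have "real_of_int k / 2 ^ N + 1 / 2 ^ N \<le> s"
        unfolding m by (simp add: divide_right_mono flip: add_divide_distrib)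
      then have h: "h (k / 2 ^ N + u) = f (k / 2 ^ N + u)" if "u \<le> 1 / 2 ^ N" for u
        using that unfolding h_def by simp
      have h0: "h (k / 2 ^ N) = f (k / 2 ^ N)" using h[of 0] by simp
      obtain s' where "f (k / 2 ^ N) * 2 ^ N \<in> \<int>" "s' = 0 \<or> s' = -1"
        "\<And>u. u \<in> dyadics \<Longrightarrow> 0 \<le> u \<Longrightarrow> u \<le> 1 / 2 ^ N \<Longrightarrow> f (k / 2 ^ N + u) = f (k / 2 ^ N) + s' * u"
        using gridD[OF f k] by metis
      then show ?thesis
        unfolding h0 by (intro conjI bexI[of _ s']) (simp_all add: h)
    next
      case False
      then have "s \<le> k / 2 ^ N" unfolding m by (simp add: divide_right_mono)
      then have h: "h (k / 2 ^ N + u) = f s" if "0 \<le> u" for u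
        using that by (cases "k / 2 ^ N + u = s") (auto simp: h_def)
      have h0: "h (k / 2 ^ N) = f s" using h[of 0] by simp
      have "f s * 2 ^ N \<in> \<int>" unfolding m by (rule gridD[OF f m_ge])
      then show ?thesis
        unfolding h0 by (intro conjI bexI[of _ 0]) (simp_all add: h)
    qed
  qed
  then show ?thesis unfolding h_def .
qed

lemma grid_cell:
  assumes "t \<in> cooling_params"
  obtains k :: int and u where "- (2 ^ N :: int) \<le> k" "u \<in> dyadics" "0 \<le> u" "u < 1 / 2 ^ N" "t = k / 2 ^ N + u"
proof -
  define k where "k = \<lfloor>t * 2 ^ N\<rfloor>"
  have "real_of_int (- (2 ^ N)) \<le> t * 2 ^ N"
    using mult_right_mono[OF cooling_paramsD(2)[OF assms], of "2 ^ N"] by simp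
  then have "- (2 ^ N :: int) \<le> k" unfolding k_def by (simp only: le_floor_iff)
  moreover have "k / 2 ^ N \<le> t" "t < k / 2 ^ N + 1 / 2 ^ N"
    using floor_correct[of "t * 2 ^ N"] unfolding k_def
    by (simp_all add: field_simps)
  ultimately show ?thesis
    using that[of k "t - k / 2 ^ N"] dyadics_diff[OF cooling_paramsD(1)[OF assms] dyadicsI[OF refl]] by simp
qed

lemma grid_antimono:
  assumes f: "grid N f" and "t \<in> cooling_params" "t' \<in> cooling_params" "t \<le> t'"
  shows "f t' \<le> f t"
proof -
  have cell_le: "f (k / 2 ^ N + v) \<le> f (k / 2 ^ N + u)"
    if k: "- (2 ^ N :: int) \<le> k" and uv: "u \<in> dyadics" "v \<in> dyadics" "0 \<le> u" "u \<le> v" "v \<le> 1 / 2 ^ N" for k :: int and u v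
  proof -
    obtain s where s: "s = 0 \<or> s = -1"
      "\<And>u. u \<in> dyadics \<Longrightarrow> 0 \<le> u \<Longrightarrow> u \<le> 1 / 2 ^ N \<Longrightarrow> f (k / 2 ^ N + u) = f (k / 2 ^ N) + s * u"
      using gridD[OF f k] by metis
    from s(1) s(2)[of u] s(2)[of v] uv show ?thesis by auto
  qed
  have points: "f (j / 2 ^ N) \<le> f (k / 2 ^ N)" if k: "- (2 ^ N :: int) \<le> k" and "k \<le> j" for j k :: int
    using \<open>k \<le> j\<close>
  proof (induction rule: int_ge_induct)
    case (step i)
    have "f (i / 2 ^ N + 1 / 2 ^ N) \<le> f (i / 2 ^ N + 0)"
      using step.hyps k by (intro cell_le) (auto intro: dyadicsI[of _ 1])
    then show ?case using step.IH by (simp add: add_divide_distrib)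
  qed simp
  obtain k :: int and u where k: "- (2 ^ N :: int) \<le> k" "u \<in> dyadics" "0 \<le> u" "u < 1 / 2 ^ N" "t = k / 2 ^ N + u"
    using grid_cell[OF assms(2)] .
  obtain j :: int and v where j: "- (2 ^ N :: int) \<le> j" "v \<in> dyadics" "0 \<le> v" "v < 1 / 2 ^ N" "t' = j / 2 ^ N + v"
    using grid_cell[OF assms(3)] .
  have "real_of_int k / 2 ^ N < (j + 1) / 2 ^ N"
    using k j assms(4) by (simp add: add_divide_distrib)
  then have "k \<le> j" by (simp add: divide_less_cancel)
  then consider "k = j" | "k + 1 \<le> j" by linarith
  then show ?thesis
  proof cases
    case 1
    then show ?thesis
      using cell_le[of k u v] k j assms(4) by simp
  next
    case 2
    have "f t' \<le> f (j / 2 ^ N + 0)"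
      unfolding j(5) using j by (intro cell_le) auto
    also have "\<dots> \<le> f ((k + 1) / 2 ^ N)"
      using points[of "k + 1" j] 2 k(1) by simp
    also have "\<dots> = f (k / 2 ^ N + 1 / 2 ^ N)"
      by (simp add: add_divide_distrib)
    also have "\<dots> \<le> f t"
      unfolding k(5) using k by (intro cell_le) (auto intro: dyadicsI[of _ 1])
    finally show ?thesis .
  qed
qed

text \<open>Meant for f the left wall and g the negated right wall. Their sum falls with slope 0, -1
  or -2, so its first zero is a grid point or the midpoint of a cell; hence the refinement to
  \<open>Suc N\<close>.\<close>

lemma grid_first_zero:
  assumes f: "grid N f" and g: "grid N g" and "f (-1) + g (-1) > 0"
    and t: "t \<in> cooling_params" "f t + g t \<le> 0"
  obtains s where "s \<in> cooling_params" "f s + g s = 0" "s * 2 ^ Suc N \<in> \<int>"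
    "\<And>u. u \<in> cooling_params \<Longrightarrow> u < s \<Longrightarrow> f u + g u > 0"
proof -
  let ?D = "\<lambda>t. f t + g t"
  have anti: "?D v \<le> ?D u" if "u \<in> cooling_params" "v \<in> cooling_params" "u \<le> v" for u v
    using grid_antimono[OF f that] grid_antimono[OF g that] by simp
  \<comment> \<open>The index n counts grid points from -1, so that a first sign change can be found
    by induction on naturals.\<close>
  define P where "P n \<longleftrightarrow> ?D (of_int (int n - 2 ^ N) / 2 ^ N) \<le> 0" for n
  have "\<exists>n. P n"
  proof -
    define k where "k = \<lceil>t * 2 ^ N\<rceil>"
    have tk: "t \<le> k / 2 ^ N" unfolding k_def by (simp add: field_simps)
    have k: "- (2 ^ N :: int) \<le> k"
    proof -
      have "real_of_int (- (2 ^ N)) \<le> t * 2 ^ N"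
        using mult_right_mono[OF cooling_paramsD(2)[OF t(1)], of "2 ^ N"] by simp
      also have "\<dots> \<le> k" unfolding k_def by simp
      finally show ?thesis by (simp only: of_int_le_iff)
    qed
    have "?D (k / 2 ^ N) \<le> 0"
      using anti[OF t(1) grid_point_params[OF k] tk] t(2) by simp
    then have "P (nat (k + 2 ^ N))" using k unfolding P_def by simp
    then show ?thesis ..
  qed
  moreover have "\<not> P 0" using assms(3) unfolding P_def by simp
  ultimately obtain n where n: "\<not> P n" "P (Suc n)"
    using exists_least_lemma[of P] by blast
  define j where "j = int n - 2 ^ N"
  have j: "- (2 ^ N :: int) \<le> j" unfolding j_def by simp
  have D: "?D (j / 2 ^ N) > 0" "?D (j / 2 ^ N + 1 / 2 ^ N) \<le> 0"
    using n unfolding P_def j_def by (simp_all add: add_divide_distrib diff_divide_distrib algebra_simps)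
  obtain p where p: "f (j / 2 ^ N) * 2 ^ N \<in> \<int>" "p = 0 \<or> p = -1"
    "\<And>u. u \<in> dyadics \<Longrightarrow> 0 \<le> u \<Longrightarrow> u \<le> 1 / 2 ^ N \<Longrightarrow> f (j / 2 ^ N + u) = f (j / 2 ^ N) + p * u"
    using gridD[OF f j] by metis
  obtain q where q: "g (j / 2 ^ N) * 2 ^ N \<in> \<int>" "q = 0 \<or> q = -1"
    "\<And>u. u \<in> dyadics \<Longrightarrow> 0 \<le> u \<Longrightarrow> u \<le> 1 / 2 ^ N \<Longrightarrow> g (j / 2 ^ N + u) = g (j / 2 ^ N) + q * u"
    using gridD[OF g j] by metis
  define c where "c = - (p + q)"
  have cell: "?D (j / 2 ^ N + u) = ?D (j / 2 ^ N) - c * u" if "u \<in> dyadics" "0 \<le> u" "u \<le> 1 / 2 ^ N" for u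
    using p(3)[OF that] q(3)[OF that] unfolding c_def by (simp add: algebra_simps)
  have one: "1 / 2 ^ N \<in> dyadics" by (rule dyadicsI[of _ 1]) simp
  have end_cell: "?D (j / 2 ^ N) \<le> c / 2 ^ N"
    using cell[OF one] D(2) by simp
  \<comment> \<open>Slope 0 is impossible in a cell where the sum goes from positive to
    nonpositive.\<close>
  have c: "c = 1 \<or> c = 2"
    using p(2) q(2) D(1) end_cell unfolding c_def by auto
  \<comment> \<open>The distance from the left end of the cell to the zero; for c = 2 it may be half
    a grid unit.\<close>
  define d where "d = ?D (j / 2 ^ N) / c"
  have d2: "d * 2 ^ Suc N \<in> \<int>"
  proof -
    have "?D (j / 2 ^ N) * 2 ^ N \<in> \<int>" using p(1) q(1) by (simp add: distrib_right)
    moreover have "d * 2 ^ Suc N = of_int (if c = 1 then 2 else 1) * (?D (j / 2 ^ N) * 2 ^ N)"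
      unfolding d_def using c by auto
    ultimately show ?thesis by (simp only: Ints_mult Ints_of_int)
  qed
  then obtain m :: int where "d * 2 ^ Suc N = m" by (auto elim: Ints_cases)
  then have "d = m / 2 ^ Suc N" by (simp add: field_simps)
  then have dd: "d \<in> dyadics" by (rule dyadicsI)
  have d: "0 < d" "d \<le> 1 / 2 ^ N" "?D (j / 2 ^ N) = c * d"
    unfolding d_def using D(1) end_cell c by (auto simp: field_simps)
  define s where "s = j / 2 ^ N + d"
  have jp: "of_int j / 2 ^ N \<in> cooling_params" by (rule grid_point_params[OF j])
  have sp: "s \<in> cooling_params"
    unfolding s_def using cooling_paramsD[OF jp] dd d by (intro cooling_paramsI) auto
  moreover have "?D s = 0"
    unfolding s_def using cell[OF dd] d by simp
  moreover have "s * 2 ^ Suc N \<in> \<int>"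
  proof -
    have "s * 2 ^ Suc N = of_int (2 * j) + d * 2 ^ Suc N" unfolding s_def by (simp add: field_simps)
    then show ?thesis using d2 by (simp only: Ints_add Ints_of_int)
  qed
  moreover have "?D u > 0" if u: "u \<in> cooling_params" "u < s" for u
  proof (cases "u \<le> j / 2 ^ N")
    case True
    then show ?thesis using anti[OF u(1) jp] D(1) by simp
  next
    case False
    define v where "v = u - j / 2 ^ N"
    have v: "v \<in> dyadics" "0 \<le> v" "v < d"
      using False u cooling_paramsD[OF jp] cooling_paramsD[OF u(1)] unfolding v_def s_def by auto
    have "?D u = c * d - c * v"
      using cell[OF v(1,2)] v d unfolding v_def by simp
    then show ?thesis using v c by auto
  qed
  ultimately show ?thesis by (rule that)
qed

section \<open>Thermographs\<close>

abbreviation integral_game :: "game \<Rightarrow> bool" where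
  "integral_game G \<equiv> \<exists>n. G \<approx> int_game n"

text \<open>As long as the walls have not crossed, this is the left stop of
  \<open>pre_cool G t\<close>, and \<open>rwall\<close> its right stop; beyond the crossing
  \<open>pre_cool G t\<close> is a number between the two.\<close>

definition lwall :: "game \<Rightarrow> real \<Rightarrow> real" where
  "lwall G t = Max ((\<lambda>G'. right_stop (cool G' t)) ` fset (lopts G)) - t"

definition rwall :: "game \<Rightarrow> real \<Rightarrow> real" where
  "rwall G t = Min ((\<lambda>G'. left_stop (cool G' t)) ` fset (ropts G)) + t"

lemma int_le_iff: "int_game m \<le> int_game n \<longleftrightarrow> m \<le> n"
  using num_le_iff[of "of_int m" "of_int n"] by (simp add: num_int)

lemma int_game_eq_iff: "int_game m \<approx> int_game n \<longleftrightarrow> m = n"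
  by (auto simp: game_eq_def int_le_iff)

lemma cool_integral:
  assumes "G \<approx> int_game n"
  shows "cool G t = int_game n"
proof -
  have "m = n" if "G \<approx> int_game m" for m
    using game_eq_trans[OF game_eq_sym[OF that] assms] by (simp add: int_game_eq_iff)
  then have "(THE m. G \<approx> int_game m) = n"
    using assms by blast
  then show ?thesis
    unfolding cool.simps[of G t] using assms by auto
qed

lemma stops_int [simp]: "left_stop (int_game n) = n" "right_stop (int_game n) = n"
  using stops_num[of "of_int n"] by (simp_all add: num_int)

lemma lopts_pre_cool: "lopts (pre_cool G t) = (\<lambda>G'. cool G' t - num_game t) |`| lopts G"
  and ropts_pre_cool: "ropts (pre_cool G t) = (\<lambda>G'. cool G' t + num_game t) |`| ropts G"
  by (subst pre_cool.simps, simp)+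

lemma integral_if_no_opts: "lopts G = {||} \<Longrightarrow> integral_game G" "ropts G = {||} \<Longrightarrow> integral_game G"
  by (rule no_lopts_imp_integer no_ropts_imp_integer, assumption)+

lemma max_lopts_pre_cool:
  assumes "\<not> integral_game G" "t \<in> dyadics"
  shows "Max (right_stop ` fset (lopts (pre_cool G t))) = lwall G t"
proof -
  have "right_stop ` fset (lopts (pre_cool G t)) = (\<lambda>G'. right_stop (cool G' t) + - t) ` fset (lopts G)"
    using assms by (simp add: lopts_pre_cool image_image right_stop_diff)
  also have "Max \<dots> = Max ((\<lambda>G'. right_stop (cool G' t)) ` fset (lopts G)) + - t"
    using integral_if_no_opts(1)[of G] assms(1)
    by (intro Max_add_commute) (auto simp: fset_eq_empty_iff)
  finally show ?thesis by (simp add: lwall_def)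
qed

lemma min_ropts_pre_cool:
  assumes "\<not> integral_game G" "t \<in> dyadics"
  shows "Min (left_stop ` fset (ropts (pre_cool G t))) = rwall G t"
proof -
  have "left_stop ` fset (ropts (pre_cool G t)) = (\<lambda>G'. left_stop (cool G' t) + t) ` fset (ropts G)"
    using assms by (simp add: ropts_pre_cool image_image left_stop_add)
  also have "Min \<dots> = Min ((\<lambda>G'. left_stop (cool G' t)) ` fset (ropts G)) + t"
    using integral_if_no_opts(2)[of G] assms(1)
    by (intro Min_add_commute) (auto simp: fset_eq_empty_iff)
  finally show ?thesis by (simp add: rwall_def)
qed

lemma pre_cool_options_nonempty:
  assumes "\<not> integral_game G"
  shows "lopts (pre_cool G t) \<noteq> {||}" "ropts (pre_cool G t) \<noteq> {||}"
  using assms integral_if_no_opts[of G] by (auto simp: lopts_pre_cool ropts_pre_cool)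

lemma stops_pre_cool:
  assumes "\<not> integral_game G" "t \<in> dyadics" "rwall G t \<le> lwall G t"
  shows "left_stop (pre_cool G t) = lwall G t" "right_stop (pre_cool G t) = rwall G t"
  using stops_eq_Max_Min[OF pre_cool_options_nonempty[OF assms(1), of t]] assms
  by (simp_all add: max_lopts_pre_cool min_ropts_pre_cool)

text \<open>Turns the freezing condition into an inequality of walls. Before they cross, the walls
  are the stops; once they have strictly crossed, the gap makes \<open>pre_cool G t\<close> a
  number.\<close>

lemma pre_cool_close_iff:
  assumes "\<not> integral_game G" "t \<in> dyadics"
  shows "(\<exists>x. close_to_number (pre_cool G t) x) \<longleftrightarrow> lwall G t \<le> rwall G t"
proof (cases "rwall G t \<le> lwall G t")
  case True
  then show ?thesis
    using stops_pre_cool[OF assms True] True by (simp add: ex_close_to_number_iff)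
next
  case False
  then obtain x where x: "has_value (pre_cool G t) x"
    using number_if_Max_less_Min[OF pre_cool_options_nonempty[OF assms(1), of t]] assms
    by (auto simp: max_lopts_pre_cool min_ropts_pre_cool)
  then show ?thesis
    using False stops_value[OF x] by (simp add: ex_close_to_number_iff)
qed

text \<open>The temperature t itself is left out, like in the freezing clause of
  \<open>cool\<close>: at the foot of the mast, \<open>cool\<close> is still
  \<open>pre_cool\<close>.\<close>

definition hot_until :: "game \<Rightarrow> real \<Rightarrow> bool" where
  "hot_until G t \<longleftrightarrow> (\<forall>s\<in>cooling_params. s < t \<longrightarrow> rwall G s < lwall G s)"

lemma cool_hot:
  assumes "\<not> integral_game G" "hot_until G t"
  shows "cool G t = pre_cool G t"
proof -
  have "\<not> (\<exists>x. close_to_number (pre_cool G s) x)" if "s \<in> cooling_params" "s < t" for s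
    using pre_cool_close_iff[OF assms(1) cooling_paramsD(1)[OF that(1)]] assms(2) that
    by (auto simp: hot_until_def)
  then have *: "\<not> (\<exists>s\<in>cooling_params. s < t \<and> (\<exists>x. close_to_number (pre_cool G s) x))"
    by blast
  show ?thesis
    unfolding cool.simps[of G t] by (simp only: assms(1) * if_False)
qed

text \<open>The mast of the thermograph of \<open>G\<close> starts at \<open>(lwall G s, s)\<close>.\<close>

definition mast_at :: "game \<Rightarrow> real \<Rightarrow> bool" where
  "mast_at G s \<longleftrightarrow> s \<in> cooling_params \<and> hot_until G s \<and> lwall G s = rwall G s"

lemma cool_frozen:
  assumes "\<not> integral_game G" "mast_at G s" "s < t"
  shows "cool G t = num_game (lwall G s)"
proof -
  let ?P = "\<lambda>s. s \<in> cooling_params \<and> s < t \<and> (\<exists>x. close_to_number (pre_cool G s) x)"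
  have s: "s \<in> cooling_params" "s \<in> dyadics" using assms(2) by (auto simp: mast_at_def dest: cooling_paramsD)
  have "?P s"
    using assms(2,3) s pre_cool_close_iff[OF assms(1) s(2)] by (simp add: mast_at_def)
  moreover have "s \<le> s'" if "?P s'" for s'
  proof -
    have "lwall G s' \<le> rwall G s'"
      using that pre_cool_close_iff[OF assms(1), of s'] by (simp add: cooling_paramsD)
    then show ?thesis
      using that assms(2) unfolding mast_at_def hot_until_def by (meson not_le)
  qed
  ultimately have "(LEAST s. ?P s) = s" by (rule Least_equality)
  moreover have "(THE x. close_to_number (pre_cool G s) x) = lwall G s"
    using stops_pre_cool[OF assms(1) s(2)] assms(2)
    by (simp add: close_to_number_iff mast_at_def)
  moreover have "\<exists>s\<in>cooling_params. s < t \<and> (\<exists>x. close_to_number (pre_cool G s) x)"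
    using \<open>?P s\<close> by blast
  ultimately show ?thesis
    unfolding cool.simps[of G t] by (simp only: assms(1) if_False if_True Let_def)
qed

section \<open>Cooling by -1\<close>

lemma number_avoidance_int':
  assumes "\<not> integral_game G" "G \<le> int_game n"
  shows "\<exists>G'. G' |\<in>| ropts G \<and> G' \<le> int_game n"
proof -
  have "\<not> integral_game (- G)"
  proof
    assume "integral_game (- G)"
    then obtain m where "- G \<approx> int_game m" ..
    then have "G \<approx> int_game (- m)"
      using game_eq_neg_iff[of "- G" "int_game m"] by (simp add: int_game_neg)
    with assms(1) show False by blast
  qed
  then obtain H where "H |\<in>| lopts (- G)" "int_game (- n) \<le> H"
    using number_avoidance_int[of "- G" "- n"] assms(2) by (auto simp: int_game_neg game_neg_le_iff)
  then show ?thesis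
    using game_neg_le_iff by (auto simp: lopts_neg int_game_neg)
qed

lemma lopts_int: "lopts (int_game n) = (if n \<le> 0 then {||} else {|int_game (n - 1)|})"
  and ropts_int: "ropts (int_game n) = (if n \<ge> 0 then {||} else {|int_game (n + 1)|})"
proof -
  have "ulp (of_int n) = 1" using den_eq_0_iff[of "of_int n"] by (simp add: ulp_def)
  then show "lopts (int_game n) = (if n \<le> 0 then {||} else {|int_game (n - 1)|})"
    "ropts (int_game n) = (if n \<ge> 0 then {||} else {|int_game (n + 1)|})"
    using lopts_num[of "of_int n"] ropts_num[of "of_int n"] num_int[of "n - 1"] num_int[of "n + 1"]
    by (simp_all add: num_int)
qed

lemma Max_image_Ints:
  fixes f :: "'a \<Rightarrow> real"
  assumes "finite A" "A \<noteq> {}" "\<And>x. x \<in> A \<Longrightarrow> f x \<in> \<int>"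
  shows "Max (f ` A) \<in> \<int>" "Min (f ` A) \<in> \<int>"
proof -
  have "Max (f ` A) \<in> f ` A" "Min (f ` A) \<in> f ` A"
    using assms by (intro Max_in Min_in; simp)+
  then show "Max (f ` A) \<in> \<int>" "Min (f ` A) \<in> \<int>"
    using assms(3) by force+
qed

text \<open>Cooling by \<open>-1\<close> rounds: the stops become the least integer above and the largest integer
  below \<open>G\<close>. In particular, only integers are frozen at \<open>-1\<close>.\<close>

lemma walls_minus_one_aux:
  assumes G: "\<not> integral_game G"
    and IH: "\<And>G'. G' |\<in>| lopts G \<or> G' |\<in>| ropts G \<Longrightarrow>
       left_stop (cool G' (-1)) \<in> \<int> \<and> right_stop (cool G' (-1)) \<in> \<int> \<and>
       (\<forall>n. (G' \<le> int_game n \<longleftrightarrow> left_stop (cool G' (-1)) \<le> n) \<and>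
            (int_game n \<le> G' \<longleftrightarrow> n \<le> right_stop (cool G' (-1))))"
  shows "lwall G (-1) \<in> \<int>" "rwall G (-1) \<in> \<int>" "rwall G (-1) < lwall G (-1)"
    "G \<le> int_game n \<longleftrightarrow> lwall G (-1) \<le> n" "int_game n \<le> G \<longleftrightarrow> n \<le> rwall G (-1)"
proof -
  have ne: "fset (lopts G) \<noteq> {}" "fset (ropts G) \<noteq> {}"
    using integral_if_no_opts[of G] G by (auto simp: fset_eq_empty_iff)
  \<comment> \<open>For integers a strict inequality is a shift by one, which is the amount that
    cooling by -1 gives to the mover.\<close>
  have int_less: "x + 1 \<le> real_of_int n \<longleftrightarrow> \<not> real_of_int n \<le> x" "real_of_int n \<le> x - 1 \<longleftrightarrow> \<not> x \<le> real_of_int n"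
    if "x \<in> \<int>" for x n
    using that by (auto elim!: Ints_cases)
  have Max: "Max ((\<lambda>G'. right_stop (cool G' (-1))) ` fset (lopts G)) \<in> \<int>"
    using ne IH by (intro Max_image_Ints) auto
  then show l: "lwall G (-1) \<in> \<int>" unfolding lwall_def by simp
  have Min: "Min ((\<lambda>G'. left_stop (cool G' (-1))) ` fset (ropts G)) \<in> \<int>"
    using ne IH by (intro Max_image_Ints) auto
  then show r: "rwall G (-1) \<in> \<int>" unfolding rwall_def by simp
  have L: "G \<le> int_game n \<longleftrightarrow> lwall G (-1) \<le> n" for n
  proof -
    have "G \<le> int_game n \<longleftrightarrow> (\<forall>G'. G' |\<in>| lopts G \<longrightarrow> \<not> int_game n \<le> G')"
    proof
      assume *: "\<forall>G'. G' |\<in>| lopts G \<longrightarrow> \<not> int_game n \<le> G'"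
      \<comment> \<open>The clause for the options of the integer follows from the one for the
        options of \<open>G\<close>: by number avoidance, n + 1 \<le> \<open>G\<close> already holds
        for a Left option of \<open>G\<close>.\<close>
      have "\<not> H \<le> G" if H: "H |\<in>| ropts (int_game n)" for H
      proof
        assume "H \<le> G"
        have H': "H = int_game (n + 1)" using H by (auto simp: ropts_int split: if_splits)
        with \<open>H \<le> G\<close> obtain G' where "G' |\<in>| lopts G" "int_game (n + 1) \<le> G'"
          using number_avoidance_int[OF G] by blast
        with * show False
          using order_trans[of "int_game n" "int_game (n + 1)" G'] by (auto simp: int_le_iff)
      qed
      with * show "G \<le> int_game n" by (subst game_le_iff) blast
    qed (subst (asm) game_le_iff, blast)
    also have "\<dots> \<longleftrightarrow> (\<forall>G'\<in>fset (lopts G). right_stop (cool G' (-1)) + 1 \<le> n)"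
      using IH int_less(1) by blast
    also have "\<dots> \<longleftrightarrow> lwall G (-1) \<le> n"
      using ne by (auto simp: lwall_def le_diff_eq[symmetric])
    finally show ?thesis .
  qed
  have R: "int_game n \<le> G \<longleftrightarrow> n \<le> rwall G (-1)" for n
  proof -
    have "int_game n \<le> G \<longleftrightarrow> (\<forall>G'. G' |\<in>| ropts G \<longrightarrow> \<not> G' \<le> int_game n)"
    proof
      assume *: "\<forall>G'. G' |\<in>| ropts G \<longrightarrow> \<not> G' \<le> int_game n"
      have "\<not> G \<le> H" if H: "H |\<in>| lopts (int_game n)" for H
      proof
        assume "G \<le> H"
        have H': "H = int_game (n - 1)" using H by (auto simp: lopts_int split: if_splits)
        with \<open>G \<le> H\<close> obtain G' where "G' |\<in>| ropts G" "G' \<le> int_game (n - 1)"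
          using number_avoidance_int'[OF G] by blast
        with * show False
          using order_trans[of G' "int_game (n - 1)" "int_game n"] by (auto simp: int_le_iff)
      qed
      with * show "int_game n \<le> G" by (subst game_le_iff) blast
    qed (subst (asm) game_le_iff, blast)
    also have "\<dots> \<longleftrightarrow> (\<forall>G'\<in>fset (ropts G). n \<le> left_stop (cool G' (-1)) - 1)"
      using IH int_less(2) by blast
    also have "\<dots> \<longleftrightarrow> n \<le> rwall G (-1)"
      using ne by (auto simp: rwall_def diff_le_eq[symmetric] le_diff_eq)
    finally show ?thesis .
  qed
  show "G \<le> int_game n \<longleftrightarrow> lwall G (-1) \<le> n" "int_game n \<le> G \<longleftrightarrow> n \<le> rwall G (-1)"
    by (rule L R)+
  show "rwall G (-1) < lwall G (-1)"
  proof (rule ccontr)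
    assume *: "\<not> rwall G (-1) < lwall G (-1)"
    \<comment> \<open>Walls that have met enclose an integer m with \<open>G \<le> m\<close> and
      \<open>m \<le> G\<close>.\<close>
    obtain m where "rwall G (-1) = of_int m" using r by (auto elim: Ints_cases)
    then have "G \<approx> int_game m"
      unfolding game_eq_def L R using * by simp
    with G show False by blast
  qed
qed

lemma hot_until_minus_one: "hot_until G (-1)"
  unfolding hot_until_def using cooling_paramsD(2) by force

lemma stops_cool_minus_one:
  "left_stop (cool G (-1)) \<in> \<int> \<and> right_stop (cool G (-1)) \<in> \<int> \<and>
   (\<forall>n. (G \<le> int_game n \<longleftrightarrow> left_stop (cool G (-1)) \<le> n) \<and>
        (int_game n \<le> G \<longleftrightarrow> n \<le> right_stop (cool G (-1))))"
proof (induction "size G" arbitrary: G rule: less_induct)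
  case less
  show ?case
  proof (cases "integral_game G")
    case True
    then obtain m where m: "G \<approx> int_game m" ..
    have "G \<le> int_game n \<longleftrightarrow> m \<le> n" "int_game n \<le> G \<longleftrightarrow> n \<le> m" for n
      using m order_trans[of G "int_game m" "int_game n"] order_trans[of "int_game m" G "int_game n"]
        order_trans[of "int_game n" G "int_game m"] order_trans[of "int_game n" "int_game m" G]
      unfolding game_eq_def int_le_iff by blast+
    then show ?thesis by (simp add: cool_integral[OF m])
  next
    case False
    have IH: "left_stop (cool G' (-1)) \<in> \<int> \<and> right_stop (cool G' (-1)) \<in> \<int> \<and>
       (\<forall>n. (G' \<le> int_game n \<longleftrightarrow> left_stop (cool G' (-1)) \<le> n) \<and>
            (int_game n \<le> G' \<longleftrightarrow> n \<le> right_stop (cool G' (-1))))"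
      if "G' |\<in>| lopts G \<or> G' |\<in>| ropts G" for G'
      using less that size_lopts size_ropts by blast
    note walls = walls_minus_one_aux[OF False IH]
    have "-1 \<in> dyadics" using dyadics_of_int[of "-1"] by simp
    then have "left_stop (cool G (-1)) = lwall G (-1)" "right_stop (cool G (-1)) = rwall G (-1)"
      using stops_pre_cool[OF False, of "-1"] walls(3) cool_hot[OF False hot_until_minus_one]
      by (simp_all add: less_imp_le)
    then show ?thesis using walls by simp
  qed
qed

lemma walls_minus_one: "\<not> integral_game G \<Longrightarrow> rwall G (-1) < lwall G (-1)"
  using walls_minus_one_aux(3) stops_cool_minus_one by blast

section \<open>Masts and the shape of thermographs\<close>

text \<open>Since the walls are strictly apart at -1, they have a first meeting point as soon as
  they meet at all. The first alternative stays open here; \<open>temperature_le\<close> excludes it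
  by a temperature at which the walls have met.\<close>

lemma mast_cases:
  assumes G: "\<not> integral_game G" and N: "grid N (lwall G)" "grid N (\<lambda>t. - rwall G t)"
  obtains "\<And>t. hot_until G t" | s where "mast_at G s" "s * 2 ^ Suc N \<in> \<int>"
proof (cases "\<exists>t\<in>cooling_params. lwall G t \<le> rwall G t")
  case True
  then obtain t where t: "t \<in> cooling_params" "lwall G t + - rwall G t \<le> 0" by auto
  obtain s where "s \<in> cooling_params" "lwall G s + - rwall G s = 0" "s * 2 ^ Suc N \<in> \<int>"
    "\<And>u. u \<in> cooling_params \<Longrightarrow> u < s \<Longrightarrow> lwall G u + - rwall G u > 0"
    using grid_first_zero[OF N _ t] walls_minus_one[OF G] by auto
  then show ?thesis
    by (intro that(2)[of s]) (auto simp: mast_at_def hot_until_def)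
next
  case False
  then show ?thesis
    by (intro that(1)) (auto simp: hot_until_def not_le)
qed

text \<open>Replaces an appeal to continuity at t: if the walls had strictly crossed at t, they
  would have met exactly at some s < t, where they are known to be apart.\<close>

lemma hot_walls_le:
  assumes G: "\<not> integral_game G" and N: "grid N (lwall G)" "grid N (\<lambda>t. - rwall G t)"
    and t: "t \<in> cooling_params" "hot_until G t"
  shows "rwall G t \<le> lwall G t"
proof (rule ccontr)
  assume *: "\<not> rwall G t \<le> lwall G t"
  obtain s where s: "s \<in> cooling_params" "lwall G s + - rwall G s = 0"
    "\<And>u. u \<in> cooling_params \<Longrightarrow> u < s \<Longrightarrow> lwall G u + - rwall G u > 0"
    using grid_first_zero[OF N _ t(1)] walls_minus_one[OF G] * by auto
  have "t \<noteq> s" "\<not> t < s" using s(2) s(3)[OF t(1)] * by auto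
  then have "rwall G s < lwall G s" using s(1) t(2) by (auto simp: hot_until_def)
  with s(2) show False by simp
qed

lemma grid_walls:
  assumes G: "\<not> integral_game G"
    and "\<And>G'. G' |\<in>| lopts G \<or> G' |\<in>| ropts G \<Longrightarrow>
      grid N (\<lambda>t. left_stop (cool G' t)) \<and> grid N (\<lambda>t. - right_stop (cool G' t))"
  shows "grid N (lwall G)" "grid N (\<lambda>t. - rwall G t)"
proof -
  have ne: "fset (lopts G) \<noteq> {}" "fset (ropts G) \<noteq> {}"
    using integral_if_no_opts[of G] G by (auto simp: fset_eq_empty_iff)
  have "grid N (\<lambda>t. Max ((\<lambda>G'. right_stop (cool G' t) - t) ` fset (lopts G)))"
  proof (rule grid_Max)
    show "grid N (\<lambda>t. right_stop (cool G' t) - t)" if "G' \<in> fset (lopts G)" for G'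
      using grid_flip[of N "\<lambda>t. - right_stop (cool G' t)"] assms(2)[of G'] that by simp
  qed (use ne in simp_all)
  moreover have "Max ((\<lambda>G'. right_stop (cool G' t) - t) ` fset (lopts G)) = lwall G t" for t
    using ne Max_add_commute[of "fset (lopts G)" "\<lambda>G'. right_stop (cool G' t)" "- t"]
    by (simp add: lwall_def)
  ultimately show "grid N (lwall G)" by simp
  have "grid N (\<lambda>t. Max ((\<lambda>G'. - left_stop (cool G' t) - t) ` fset (ropts G)))"
  proof (rule grid_Max)
    show "grid N (\<lambda>t. - left_stop (cool G' t) - t)" if "G' \<in> fset (ropts G)" for G'
      using grid_flip[of N "\<lambda>t. left_stop (cool G' t)"] assms(2)[of G'] that by simp
  qed (use ne in simp_all)
  moreover have "Max ((\<lambda>G'. - left_stop (cool G' t) - t) ` fset (ropts G)) = - rwall G t" for t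
    using ne Max_add_commute[of "fset (ropts G)" "\<lambda>G'. - left_stop (cool G' t)" "- t"]
    by (simp add: rwall_def image_image)
  ultimately show "grid N (\<lambda>t. - rwall G t)" by simp
qed

lemma common_grid:
  assumes "finite A" "\<And>x. x \<in> A \<Longrightarrow> \<exists>N. grid N (f x) \<and> grid N (g x)"
  shows "\<exists>N. \<forall>x\<in>A. grid N (f x) \<and> grid N (g x)"
  using assms
proof (induction A rule: finite_induct)
  case (insert x A)
  then obtain N M where "\<forall>y\<in>A. grid N (f y) \<and> grid N (g y)" "grid M (f x) \<and> grid M (g x)"
    by (metis insertI1 insertI2)
  then have "\<forall>y\<in>insert x A. grid (max N M) (f y) \<and> grid (max N M) (g y)"
    by (auto intro: grid_refine[of N "max N M"] grid_refine[of M "max N M"])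
  then show ?case ..
qed simp

text \<open>The finitely many options share a grid, which the walls inherit. Freezing costs one more
  binary digit, because the walls may approach each other with combined slope 2.\<close>

lemma grid_stops_cool: "\<exists>N. grid N (\<lambda>t. left_stop (cool G t)) \<and> grid N (\<lambda>t. - right_stop (cool G t))"
proof (induction "size G" arbitrary: G rule: less_induct)
  case less
  show ?case
  proof (cases "integral_game G")
    case True
    then obtain n where n: "G \<approx> int_game n" ..
    have "grid 0 (\<lambda>t. left_stop (cool G t))" "grid 0 (\<lambda>t. - right_stop (cool G t))"
      unfolding cool_integral[OF n] by (intro grid_const; simp)+
    then show ?thesis by blast
  next
    case False
    have "\<exists>N. \<forall>G'\<in>fset (lopts G |\<union>| ropts G).
        grid N (\<lambda>t. left_stop (cool G' t)) \<and> grid N (\<lambda>t. - right_stop (cool G' t))"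
      by (rule common_grid) (auto intro: less simp: size_lopts size_ropts)
    then obtain N where opts: "G' |\<in>| lopts G \<or> G' |\<in>| ropts G \<Longrightarrow>
        grid N (\<lambda>t. left_stop (cool G' t)) \<and> grid N (\<lambda>t. - right_stop (cool G' t))" for G'
      by auto
    have N: "grid N (lwall G)" "grid N (\<lambda>t. - rwall G t)"
      by (rule grid_walls[OF False], erule opts)+
    have hot: "left_stop (cool G t) = lwall G t" "right_stop (cool G t) = rwall G t"
      if "t \<in> cooling_params" "hot_until G t" for t
      using stops_pre_cool[OF False _ hot_walls_le[OF False N that]] cool_hot[OF False that(2)] that(1)
      by (simp_all add: cooling_paramsD)
    from False N show ?thesis
    proof (cases rule: mast_cases)
      case 1
      have "grid N (\<lambda>t. left_stop (cool G t))"
        by (rule grid_cong[OF _ N(1)]) (simp add: hot 1)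
      moreover have "grid N (\<lambda>t. - right_stop (cool G t))"
        by (rule grid_cong[OF _ N(2)]) (simp add: hot 1)
      ultimately show ?thesis by blast
    next
      case (2 s)
      have s: "s \<in> cooling_params" "hot_until G s" "lwall G s = rwall G s"
        using 2(1) by (auto simp: mast_at_def)
      have hot': "hot_until G t" if "t \<le> s" for t
        using s(2) that by (auto simp: hot_until_def)
      have x: "lwall G s \<in> dyadics" using hot(1)[OF s(1,2)] left_stop_dyadics by metis
      have "grid (Suc N) (\<lambda>t. left_stop (cool G t))"
        by (rule grid_cong[OF _ grid_freeze[OF grid_refine_Suc[OF N(1)] 2(2) cooling_paramsD(2)[OF s(1)]]])
          (auto simp: hot hot' cool_frozen[OF False 2(1)] stops_num x)
      moreover have "grid (Suc N) (\<lambda>t. - right_stop (cool G t))"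
        by (rule grid_cong[OF _ grid_freeze[OF grid_refine_Suc[OF N(2)] 2(2) cooling_paramsD(2)[OF s(1)]]])
          (auto simp: hot hot' cool_frozen[OF False 2(1)] stops_num x s(3)[symmetric])
      ultimately show ?thesis by blast
    qed
  qed
qed

lemma grid_walls_ex:
  assumes "\<not> integral_game G"
  obtains N where "grid N (lwall G)" "grid N (\<lambda>t. - rwall G t)"
proof -
  have "\<exists>N. \<forall>G'\<in>fset (lopts G |\<union>| ropts G).
      grid N (\<lambda>t. left_stop (cool G' t)) \<and> grid N (\<lambda>t. - right_stop (cool G' t))"
    by (rule common_grid) (auto intro: grid_stops_cool)
  then obtain N where opts: "G' |\<in>| lopts G \<or> G' |\<in>| ropts G \<Longrightarrow>
      grid N (\<lambda>t. left_stop (cool G' t)) \<and> grid N (\<lambda>t. - right_stop (cool G' t))" for G'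
    by auto
  show ?thesis
    by (rule that; rule grid_walls[OF assms], erule opts)
qed

lemma rwall_mono:
  assumes "\<not> integral_game G" "s \<in> cooling_params" "t \<in> cooling_params" "s \<le> t"
  shows "rwall G s \<le> rwall G t"
proof -
  obtain N where "grid N (\<lambda>t. - rwall G t)" using assms(1) by (rule grid_walls_ex)
  from grid_antimono[OF this assms(2-)] show ?thesis by simp
qed

text \<open>The thermograph of a non-integral game: walls up to the mast, one constant above it.
  From here on, cooling such a game is accessed only through this case distinction.\<close>

lemma stops_cool_cases:
  assumes G: "\<not> integral_game G" and t: "t \<in> cooling_params"
  obtains (hot) "rwall G t \<le> lwall G t" "hot_until G t"
      "left_stop (cool G t) = lwall G t" "right_stop (cool G t) = rwall G t"
  | (frozen) s where "mast_at G s" "s < t" "left_stop (cool G t) = lwall G s" "right_stop (cool G t) = lwall G s"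
proof -
  obtain N where N: "grid N (lwall G)" "grid N (\<lambda>t. - rwall G t)"
    using G by (rule grid_walls_ex)
  have *: "rwall G t \<le> lwall G t" "left_stop (cool G t) = lwall G t" "right_stop (cool G t) = rwall G t"
    if "t \<in> cooling_params" "hot_until G t" for t
    using stops_pre_cool[OF G _ hot_walls_le[OF G N that]] cool_hot[OF G that(2)] that(1)
      hot_walls_le[OF G N that]
    by (simp_all add: cooling_paramsD)
  show ?thesis
  proof (cases "hot_until G t")
    case True
    then show ?thesis using hot *[OF t] by blast
  next
    case False
    with mast_cases[OF G N] obtain s where s: "mast_at G s" by blast
    then have "hot_until G s" "s \<in> cooling_params" by (auto simp: mast_at_def)
    with False have "s < t" by (force simp: hot_until_def)
    moreover have "lwall G s \<in> dyadics"
      using *[of s] s left_stop_dyadics by (metis mast_at_def)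
    ultimately show ?thesis
      using frozen[OF s] cool_frozen[OF G s] by (simp add: stops_num)
  qed
qed

section \<open>Thermographs of negatives\<close>

lemma mast_at_unique:
  assumes "mast_at G s" "mast_at G s'"
  shows "s = s'"
proof -
  have "\<not> s < s'" if "mast_at G s" "mast_at G s'" for s s'
    using that by (auto simp: mast_at_def hot_until_def)
  from this[of s s'] this[of s' s] assms show ?thesis by simp
qed

lemma mast_at_not_hot: "mast_at G s \<Longrightarrow> s < t \<Longrightarrow> \<not> hot_until G t"
  by (auto simp: mast_at_def hot_until_def)

lemma integral_neg_iff: "integral_game (- G) \<longleftrightarrow> integral_game G"
proof -
  have "integral_game (- H)" if "integral_game H" for H
    using that game_eq_neg_iff[of H] by (metis int_game_neg)
  from this[of G] this[of "- G"] show ?thesis by auto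
qed

text \<open>Negation exchanges and negates the walls, so they meet at the same temperature and the
  masts correspond.\<close>

lemma stops_cool_neg:
  assumes "t \<in> cooling_params"
  shows "left_stop (cool (- G) t) = - right_stop (cool G t) \<and> right_stop (cool (- G) t) = - left_stop (cool G t)"
  using assms
proof (induction "size G" arbitrary: G t rule: less_induct)
  case less
  show ?case
  proof (cases "integral_game G")
    case True
    then obtain n where n: "G \<approx> int_game n" ..
    then have "- G \<approx> int_game (- n)"
      by (simp add: int_game_neg game_eq_neg_iff)
    then show ?thesis
      by (simp add: cool_integral[OF n] cool_integral[of "- G" "- n"])
  next
    case False
    then have False': "\<not> integral_game (- G)" by (simp only: integral_neg_iff not_False_eq_True)
    have ne: "fset (lopts G) \<noteq> {}" "fset (ropts G) \<noteq> {}"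
      using integral_if_no_opts[of G] False by (auto simp: fset_eq_empty_iff)
    have walls: "lwall (- G) s = - rwall G s" "rwall (- G) s = - lwall G s" if s: "s \<in> cooling_params" for s
    proof -
      have "(\<lambda>G'. right_stop (cool G' s)) ` fset (lopts (- G)) = uminus ` (\<lambda>G'. left_stop (cool G' s)) ` fset (ropts G)"
        using less.hyps[OF size_ropts s] by (auto simp: lopts_neg image_image intro!: image_cong)
      then show "lwall (- G) s = - rwall G s"
        using ne by (simp add: lwall_def rwall_def)
      have "(\<lambda>G'. left_stop (cool G' s)) ` fset (ropts (- G)) = uminus ` (\<lambda>G'. right_stop (cool G' s)) ` fset (lopts G)"
        using less.hyps[OF size_lopts s] by (auto simp: ropts_neg image_image intro!: image_cong)
      then show "rwall (- G) s = - lwall G s"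
        using ne by (simp add: lwall_def rwall_def)
    qed
    then have hot: "hot_until (- G) s = hot_until G s" and mast: "mast_at (- G) s = mast_at G s" for s
      by (auto simp: hot_until_def mast_at_def)
    show ?thesis
    proof (cases rule: stops_cool_cases[OF False less.prems])
      case hot': 1
      then show ?thesis
        using mast_at_not_hot[of "- G"]
        by (cases rule: stops_cool_cases[OF False' less.prems]) (auto simp: hot walls[OF less.prems])
    next
      case frozen: (2 s)
      show ?thesis
      proof (cases rule: stops_cool_cases[OF False' less.prems])
        case 1
        then show ?thesis using mast_at_not_hot[OF frozen(1,2)] by (simp add: hot)
      next
        case (2 s')
        then have "s' = s" using mast_at_unique[OF _ frozen(1)] by (simp add: mast)
        moreover have "s \<in> cooling_params" "lwall G s = rwall G s"
          using frozen(1) by (auto simp: mast_at_def)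
        ultimately show ?thesis
          using 2 frozen by (simp add: walls)
      qed
    qed
  qed
qed

lemma left_stop_cool_neg: "t \<in> cooling_params \<Longrightarrow> left_stop (cool (- G) t) = - right_stop (cool G t)"
  and right_stop_cool_neg: "t \<in> cooling_params \<Longrightarrow> right_stop (cool (- G) t) = - left_stop (cool G t)"
  using stops_cool_neg by blast+

section \<open>Integer bounds on the stops of cooled games\<close>

lemma rwall_le: "G' |\<in>| ropts G \<Longrightarrow> rwall G t \<le> left_stop (cool G' t) + t"
  by (simp add: rwall_def)

lemma lwall_le:
  assumes "\<not> integral_game G" "\<And>G'. G' |\<in>| lopts G \<Longrightarrow> right_stop (cool G' t) \<le> x + t"
  shows "lwall G t \<le> x"
proof -
  have "fset (lopts G) \<noteq> {}"
    using integral_if_no_opts(1)[of G] assms(1) by (auto simp: fset_eq_empty_iff)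
  then have "Max ((\<lambda>G'. right_stop (cool G' t)) ` fset (lopts G)) \<le> x + t"
    using assms(2) by (subst Max_le_iff) auto
  then show ?thesis by (simp add: lwall_def)
qed

lemma eq_int_le_iff:
  assumes "G \<approx> int_game m"
  shows "H \<le> G \<longleftrightarrow> H \<le> int_game m" "G \<le> H \<longleftrightarrow> int_game m \<le> H"
  using assms order_trans[of H G "int_game m"] order_trans[of H "int_game m" G]
    order_trans[of "int_game m" G H] order_trans[of G "int_game m" H]
  unfolding game_eq_def by blast+

text \<open>The three claims need each other. For \<open>G \<le> n\<close>, no Left option is \<ge>
  n, so the second claim bounds its right stop. For the second claim, Right either has a move to
  some H \<le> n, whose price t is the third claim, or \<open>G \<le> n - 1\<close>. The third claim
  holds below the mast by definition of the wall, and above it because the right wall is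
  increasing.\<close>

lemma stops_cool_le_aux:
  assumes "t \<in> cooling_params"
  shows "(G \<le> int_game n \<longrightarrow> left_stop (cool G t) \<le> n) \<and>
    (\<not> int_game n \<le> G \<longrightarrow> right_stop (cool G t) \<le> n + t) \<and>
    (\<forall>H. H |\<in>| ropts G \<longrightarrow> right_stop (cool G t) \<le> left_stop (cool H t) + t)"
  using assms
proof (induction "nsize G" arbitrary: G n t rule: less_induct)
  case less
  note IH = less.hyps[THEN conjunct1, THEN mp] less.hyps[THEN conjunct2, THEN conjunct1, THEN mp]
  have t: "t \<in> cooling_params" by fact
  have A: "left_stop (cool G t) \<le> n" if "G \<le> int_game n" for n
  proof (cases "integral_game G")
    case True
    then obtain m where m: "G \<approx> int_game m" ..
    then show ?thesis
      using that eq_int_le_iff(2)[OF m] by (simp add: cool_integral[OF m] int_le_iff)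
  next
    case False
    have *: "lwall G s \<le> n" if s: "s \<in> cooling_params" for s
    proof (rule lwall_le[OF False])
      fix G' assume G': "G' |\<in>| lopts G"
      then have "\<not> int_game n \<le> G'"
        using order_trans[OF \<open>G \<le> int_game n\<close>] not_ge_lopt by blast
      then show "right_stop (cool G' s) \<le> n + s"
        using IH(2)[OF nsize_lopts[OF G'] s] by blast
    qed
    show ?thesis
    proof (cases rule: stops_cool_cases[OF False t])
      case 1
      then show ?thesis using *[OF t] by simp
    next
      case (2 s)
      then show ?thesis using *[of s] by (simp add: mast_at_def)
    qed
  qed
  have B: "right_stop (cool G t) \<le> left_stop (cool H t) + t" if H: "H |\<in>| ropts G" for H
  proof (cases "integral_game G")
    case True
    then obtain m where m: "G \<approx> int_game m" ..
    \<comment> \<open>A Right option of a game with value m is not \<le> m; read for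
      \<open>- H\<close>, this is an instance of the second claim.\<close>
    have "\<not> int_game (- m) \<le> - H"
      using not_ropt_le[OF H] by (simp add: int_game_neg game_neg_le_iff eq_int_le_iff[OF m])
    then have "right_stop (cool (- H) t) \<le> of_int (- m) + t"
      using IH(2)[of "- H" t "- m"] nsize_ropts[OF H] t by simp
    then show ?thesis
      using right_stop_cool_neg[OF t, of H] by (simp add: cool_integral[OF m])
  next
    case False
    show ?thesis
    proof (cases rule: stops_cool_cases[OF False t])
      case 1
      then show ?thesis using rwall_le[OF H, of t] by simp
    next
      case (2 s)
      then have "right_stop (cool G t) = rwall G s" "s \<in> cooling_params" by (simp_all add: mast_at_def)
      then show ?thesis
        using rwall_le[OF H, of t] rwall_mono[OF False _ t, of s] 2(2) by simp
    qed
  qed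
  have "right_stop (cool G t) \<le> n + t" if "\<not> int_game n \<le> G"
  proof -
    from that consider X where "X |\<in>| lopts (int_game n)" "G \<le> X" | H where "H |\<in>| ropts G" "H \<le> int_game n"
      unfolding game_le_iff[of "int_game n"] by blast
    then show ?thesis
    proof cases
      case 1
      then have "G \<le> int_game (n - 1)" by (auto simp: lopts_int split: if_splits)
      \<comment> \<open>RS \<le> n - 1 \<le> n + t; the lower limit -1 for temperatures is what
        makes this work.\<close>
      from A[OF this] show ?thesis
        using right_stop_le_left_stop[of "cool G t"] cooling_paramsD(2)[OF t] by simp
    next
      case 2
      then show ?thesis
        using B[OF 2(1)] IH(1)[OF nsize_ropts[OF 2(1)] t 2(2)] by simp
    qed
  qed
  with A B show ?case by blast
qed

lemma left_stop_cool_le_int: "t \<in> cooling_params \<Longrightarrow> G \<le> int_game n \<Longrightarrow> left_stop (cool G t) \<le> n"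
  using stops_cool_le_aux by blast

lemma right_stop_cool_le: "t \<in> cooling_params \<Longrightarrow> H |\<in>| ropts G \<Longrightarrow> right_stop (cool G t) \<le> left_stop (cool H t) + t"
  using stops_cool_le_aux by blast

section \<open>Bounding the temperature\<close>

lemma temperature_integral:
  assumes "integral_game G"
  shows "temperature G = -1"
proof -
  obtain n where n: "G \<approx> int_game n" using assms ..
  have "-1 \<in> cooling_params"
    using dyadics_of_int[of "-1"] by (simp add: cooling_params_def)
  then show ?thesis
    unfolding temperature_def
    by (intro Least_equality) (auto simp: cool_integral[OF n] ex_close_to_number_iff cooling_params_def)
qed

text \<open>Below the mast the stops differ, at its foot they agree, so the temperature is the foot
  of the mast; walls that have met at t place the foot at or below t.\<close>

lemma temperature_le:
  assumes G: "\<not> integral_game G" and t: "t \<in> cooling_params" "lwall G t \<le> rwall G t"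
  shows "temperature G \<le> t"
proof -
  obtain N where N: "grid N (lwall G)" "grid N (\<lambda>t. - rwall G t)"
    using G by (rule grid_walls_ex)
  have stops: "left_stop (cool G s) = lwall G s" "right_stop (cool G s) = rwall G s"
    if "s \<in> cooling_params" "hot_until G s" for s
    by (cases rule: stops_cool_cases[OF G that(1)]; use that mast_at_not_hot in blast)+
  obtain s where s: "mast_at G s"
  proof (cases rule: mast_cases[OF G N])
    case 1
    have "t + 1 \<in> dyadics" using cooling_paramsD(1)[OF t(1)] dyadics_of_int[of 1] by simp
    \<comment> \<open>\<open>hot_until\<close> excludes its endpoint, so t + 1 is used to reach
      t.\<close>
    then have "hot_until G (t + 1)" using 1 by blast
    then show ?thesis using t by (auto simp: hot_until_def)
  qed
  then have s': "s \<in> cooling_params" "hot_until G s" "lwall G s = rwall G s" by (auto simp: mast_at_def)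
  have "temperature G = s"
    unfolding temperature_def
  proof (rule Least_equality)
    show "s \<in> cooling_params \<and> (\<exists>x. close_to_number (cool G s) x)"
      using stops[OF s'(1,2)] s' by (simp add: ex_close_to_number_iff)
  next
    fix u assume u: "u \<in> cooling_params \<and> (\<exists>x. close_to_number (cool G u) x)"
    show "s \<le> u"
    proof (rule ccontr)
      assume "\<not> s \<le> u"
      then have "hot_until G u" "rwall G u < lwall G u"
        using s'(2) u by (auto simp: hot_until_def)
      with stops[of u] u show False by (simp add: ex_close_to_number_iff)
    qed
  qed
  moreover have "s \<le> t"
    using s'(2) t by (force simp: hot_until_def)
  ultimately show ?thesis by simp
qed

text \<open>The bound on the Left options puts the left wall at \<le> 0, and symmetry puts the right
  wall at \<ge> 0, so the walls have met. The stops are then equal, and each is the negative of the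
  other.\<close>

lemma temperature_self_negative:
  assumes neg: "- G = G" and t: "t \<in> cooling_params"
    and left: "\<And>G'. G' |\<in>| lopts G \<Longrightarrow> right_stop (cool G' t) \<le> t"
  shows "left_stop (cool G t) = 0" "temperature G \<le> t"
proof -
  have stops: "left_stop (cool G t) = - right_stop (cool G t)"
    using left_stop_cool_neg[OF t, of G] neg by simp
  have "left_stop (cool G t) = 0 \<and> temperature G \<le> t"
  proof (cases "integral_game G")
    case True
    then obtain n where n: "G \<approx> int_game n" ..
    show ?thesis
      using stops temperature_integral[OF True] cooling_paramsD(2)[OF t]
      by (simp add: cool_integral[OF n])
  next
    case False
    have l: "lwall G t \<le> 0" using left by (intro lwall_le[OF False]) simp
    have "fset (ropts G) \<noteq> {}"
      using integral_if_no_opts(2)[of G] False by (auto simp: fset_eq_empty_iff)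
    then have "Min ((\<lambda>G'. left_stop (cool G' t)) ` fset (ropts G)) \<in> (\<lambda>G'. left_stop (cool G' t)) ` fset (ropts G)"
      by (intro Min_in) simp_all
    then obtain H where H: "H |\<in>| ropts G" "rwall G t = left_stop (cool H t) + t"
      unfolding rwall_def by auto
    then have "- H |\<in>| lopts G" using neg lopts_neg[of G] by auto
    from left[OF this] have r: "0 \<le> rwall G t"
      using H(2) right_stop_cool_neg[OF t, of H] by simp
    have "left_stop (cool G t) = right_stop (cool G t)"
      by (cases rule: stops_cool_cases[OF False t]) (use l r in auto)
    then show ?thesis
      using stops temperature_le[OF False t] l r by simp
  qed
  then show "left_stop (cool G t) = 0" "temperature G \<le> t" by auto
qed

text \<open>The interface between thermographs and Snort. The induction is on the size of
  \<open>G\<close>: a symmetric reply H is two moves further, so its Left options already satisfy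
  the bound.\<close>

lemma temperature_le_symmetric_strategy:
  assumes S: "\<And>G. G \<in> S \<Longrightarrow> - G = G"
    and reply: "\<And>G G'. G \<in> S \<Longrightarrow> G' |\<in>| lopts G \<Longrightarrow> G' \<le> int_game n \<or> (\<exists>H\<in>S. H |\<in>| ropts G')"
    and t: "t \<in> cooling_params" "of_int n \<le> t" and G: "G \<in> S"
  shows "temperature G \<le> t"
proof -
  have left: "right_stop (cool G' t) \<le> t" if "G \<in> S" "G' |\<in>| lopts G" for G G'
    using that
  proof (induction "size G" arbitrary: G G' rule: less_induct)
    case less
    from reply[OF less.prems] show ?case
    proof (elim disjE bexE)
      assume "G' \<le> int_game n"
      then show ?thesis
        using left_stop_cool_le_int[OF t(1)] right_stop_le_left_stop[of "cool G' t"] t(2) by fastforce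
    next
      fix H assume H: "H \<in> S" "H |\<in>| ropts G'"
      have "size H < size G"
        using size_ropts[OF H(2)] size_lopts[OF less.prems(2)] by simp
      then have "left_stop (cool H t) = 0"
        using less.hyps[OF _ H(1)] by (intro temperature_self_negative(1)[OF S[OF H(1)] t(1)]) blast
      then show ?thesis
        using right_stop_cool_le[OF t(1) H(2)] by simp
    qed
  qed
  show ?thesis
    using left[OF G] by (rule temperature_self_negative(2)[OF S[OF G] t(1)])
qed

section \<open>Snort on a path\<close>

abbreviation path_snort :: "nat \<Rightarrow> (nat \<Rightarrow> player option) \<Rightarrow> game" where
  "path_snort n \<equiv> snort (fset_of_list [0..<n]) (\<lambda>i j. j = Suc i \<or> i = Suc j)"

definition legal :: "nat \<Rightarrow> (nat \<Rightarrow> player option) \<Rightarrow> player \<Rightarrow> nat \<Rightarrow> bool" where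
  "legal n c p v \<longleftrightarrow> v < n \<and> c v = None \<and> (\<forall>u<n. v = Suc u \<or> u = Suc v \<longrightarrow> c u \<noteq> Some (opponent p))"

lemma legal_neighbour: "legal n c p v \<Longrightarrow> u < n \<Longrightarrow> v = Suc u \<or> u = Suc v \<Longrightarrow> c u \<noteq> Some (opponent p)"
  unfolding legal_def by blast

lemma snort_moves_path:
  "v |\<in>| snort_moves (fset_of_list [0..<n]) (\<lambda>i j. j = Suc i \<or> i = Suc j) c p \<longleftrightarrow> legal n c p v"
  by (auto simp: snort_moves_def legal_def fset_of_list_elem)

lemma lopts_path_snort: "H |\<in>| lopts (path_snort n c) \<longleftrightarrow> (\<exists>v. legal n c Left v \<and> H = path_snort n (c(v \<mapsto> Left)))"
  and ropts_path_snort: "H |\<in>| ropts (path_snort n c) \<longleftrightarrow> (\<exists>v. legal n c Right v \<and> H = path_snort n (c(v \<mapsto> Right)))"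
  by (subst snort.simps; force simp flip: snort_moves_path)+

text \<open>Serves twice: over the whole path as the induction measure, over a central block as the
  number of free moves that Right may have to spend.\<close>

definition empties :: "(nat \<Rightarrow> player option) \<Rightarrow> nat set \<Rightarrow> nat" where
  "empties c B = card {i \<in> B. c i = None}"

lemma empties_upd_in: "finite B \<Longrightarrow> v \<in> B \<Longrightarrow> c v = None \<Longrightarrow> empties c B = Suc (empties (c(v \<mapsto> p)) B)"
proof -
  assume *: "finite B" "v \<in> B" "c v = None"
  then have "{i \<in> B. c i = None} = insert v {i \<in> B. (c(v \<mapsto> p)) i = None}" by auto
  with * show ?thesis by (simp add: empties_def)
qed

lemma empties_upd_notin: "v \<notin> B \<Longrightarrow> empties (c(v \<mapsto> p)) B = empties c B"
  unfolding empties_def by (rule arg_cong[of _ _ card]) auto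

section \<open>Reflections of the path\<close>

lemma opponent_opponent [simp]: "opponent (opponent p) = p"
  by (cases p) auto

lemma map_opponent_eq_Some: "map_option opponent x = Some p \<longleftrightarrow> x = Some (opponent p)"
  by (cases x) auto

text \<open>\<pi> is the identity or \<open>opponent\<close>, so one lemma serves the reflection
  that keeps colours and the one that exchanges them.\<close>

lemma legal_reflect:
  assumes c': "\<And>i. i < n \<Longrightarrow> c' (n - 1 - i) = map_option \<pi> (c i)"
    and \<pi>: "inj \<pi>" "\<And>p. \<pi> (opponent p) = opponent (\<pi> p)"
    and "v < n"
  shows "legal n c' (\<pi> p) (n - 1 - v) \<longleftrightarrow> legal n c p v"
proof -
  have eq: "c' (n - 1 - u) = Some (opponent (\<pi> p)) \<longleftrightarrow> c u = Some (opponent p)" if "u < n" for u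
    using c'[OF that] \<pi> by (cases "c u") (auto simp: inj_eq simp flip: \<pi>(2))
  have "(\<forall>u<n. n - 1 - v = Suc u \<or> u = Suc (n - 1 - v) \<longrightarrow> c' u \<noteq> Some (opponent (\<pi> p))) \<longleftrightarrow>
    (\<forall>u<n. v = Suc u \<or> u = Suc v \<longrightarrow> c u \<noteq> Some (opponent p))" (is "?L \<longleftrightarrow> ?R")
  proof
    assume L: ?L
    show ?R
    proof (intro allI impI)
      fix u assume u: "u < n" "v = Suc u \<or> u = Suc v"
      then have "n - 1 - v = Suc (n - 1 - u) \<or> n - 1 - u = Suc (n - 1 - v)" using \<open>v < n\<close> by auto
      then show "c u \<noteq> Some (opponent p)" using L eq[OF u(1)] u(1) by auto
    qed
  next
    assume R: ?R
    show ?L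
    proof (intro allI impI)
      fix u assume u: "u < n" "n - 1 - v = Suc u \<or> u = Suc (n - 1 - v)"
      define w where "w = n - 1 - u"
      have w: "w < n" "u = n - 1 - w" using u(1) unfolding w_def by auto
      then have "v = Suc w \<or> w = Suc v" using u \<open>v < n\<close> by auto
      then show "c' u \<noteq> Some (opponent (\<pi> p))" using R eq[OF w(1)] w by auto
    qed
  qed
  then show ?thesis
    unfolding legal_def using c'[OF \<open>v < n\<close>] \<open>v < n\<close> by auto
qed

lemma reflect_upd:
  fixes n :: nat
  assumes "\<And>i. i < n \<Longrightarrow> c' (n - 1 - i) = map_option \<pi> (c i)" "v < n" "i < n"
  shows "(c'(n - 1 - v \<mapsto> \<pi> p)) (n - 1 - i) = map_option \<pi> ((c(v \<mapsto> p)) i)"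
proof -
  have "n - 1 - i = n - 1 - v \<longleftrightarrow> i = v" using assms(2,3) by arith
  then show ?thesis using assms(1)[OF assms(3)] by simp
qed

text \<open>Reindexes moves by their mirror images, so that options of reflected positions can be
  matched one by one.\<close>

lemma ex_reflect: "(\<exists>v. legal n c p v \<and> P v) \<longleftrightarrow> (\<exists>v<n. legal n c p (n - 1 - v) \<and> P (n - 1 - v))"
proof
  assume "\<exists>v. legal n c p v \<and> P v"
  then obtain v where "legal n c p v" "P v" by blast
  moreover from this have "v < n" by (simp add: legal_def)
  ultimately show "\<exists>v<n. legal n c p (n - 1 - v) \<and> P (n - 1 - v)"
    by (intro exI[of _ "n - 1 - v"]) auto
qed blast

lemma ex_legal_less: "(\<exists>v. legal n c p v \<and> P v) \<longleftrightarrow> (\<exists>v<n. legal n c p v \<and> P v)"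
  by (auto simp: legal_def)

lemma path_snort_reflect:
  "(\<And>i. i < n \<Longrightarrow> c' (n - 1 - i) = c i) \<Longrightarrow> path_snort n c' = path_snort n c"
proof (induction "empties c {..<n}" arbitrary: c c' rule: less_induct)
  case less
  have c': "c' (n - 1 - i) = map_option id (c i)" if "i < n" for i
    using less.prems[OF that] by (simp add: option.map_id)
  have legal: "legal n c' p (n - 1 - v) \<longleftrightarrow> legal n c p v" if "v < n" for v p
    using legal_reflect[of n c' id c v p] c' that by simp
  have IH: "path_snort n (c'(n - 1 - v \<mapsto> p)) = path_snort n (c(v \<mapsto> p))" if "v < n" "legal n c p v" for v p
  proof (rule less.hyps)
    show "empties (c(v \<mapsto> p)) {..<n} < empties c {..<n}"
      using that empties_upd_in[of "{..<n}" v c p] by (simp add: legal_def)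
    show "(c'(n - 1 - v \<mapsto> p)) (n - 1 - i) = (c(v \<mapsto> p)) i" if "i < n" for i
      using reflect_upd[of n c' id c v i p] c' \<open>v < n\<close> that by (simp add: option.map_id)
  qed
  show ?case
  proof (rule game_eqI; rule fset_eqI)
    show "H |\<in>| lopts (path_snort n c') \<longleftrightarrow> H |\<in>| lopts (path_snort n c)" for H
      unfolding lopts_path_snort ex_reflect[of n c'] ex_legal_less[of n c]
      by (intro ex_cong1 conj_cong refl) (simp_all only: legal IH)
    show "H |\<in>| ropts (path_snort n c') \<longleftrightarrow> H |\<in>| ropts (path_snort n c)" for H
      unfolding ropts_path_snort ex_reflect[of n c'] ex_legal_less[of n c]
      by (intro ex_cong1 conj_cong refl) (simp_all only: legal IH)
  qed
qed

text \<open>An equality of forms, so an antisymmetric position satisfies \<open>- G = G\<close>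
  literally.\<close>

lemma path_snort_reflect_neg:
  "(\<And>i. i < n \<Longrightarrow> c' (n - 1 - i) = map_option opponent (c i)) \<Longrightarrow> path_snort n c' = - path_snort n c"
proof (induction "empties c {..<n}" arbitrary: c c' rule: less_induct)
  case less
  note c' = less.prems
  have inj: "inj opponent" by (rule injI) (metis opponent_opponent)
  have legal: "legal n c' (opponent p) (n - 1 - v) \<longleftrightarrow> legal n c p v" if "v < n" for v p
    by (rule legal_reflect) (simp_all only: c' inj that opponent_opponent)
  have IH: "path_snort n (c'(n - 1 - v \<mapsto> opponent p)) = - path_snort n (c(v \<mapsto> p))" if "v < n" "legal n c p v" for v p
  proof (rule less.hyps)
    show "empties (c(v \<mapsto> p)) {..<n} < empties c {..<n}"
      using that empties_upd_in[of "{..<n}" v c p] by (simp add: legal_def)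
    show "(c'(n - 1 - v \<mapsto> opponent p)) (n - 1 - i) = map_option opponent ((c(v \<mapsto> p)) i)" if "i < n" for i
      using reflect_upd[of n c' opponent c v i p] c' \<open>v < n\<close> that by simp
  qed
  show ?case
  proof (rule game_eqI; rule fset_eqI)
    have opts: "H |\<in>| lopts (- path_snort n c) \<longleftrightarrow> (\<exists>v. legal n c Right v \<and> H = - path_snort n (c(v \<mapsto> Right)))" for H
      using ropts_path_snort[of _ n c] unfolding lopts_neg by (auto 0 3)
    show "H |\<in>| lopts (path_snort n c') \<longleftrightarrow> H |\<in>| lopts (- path_snort n c)" for H
      unfolding opts lopts_path_snort ex_reflect[of n c'] ex_legal_less[of n c]
      by (intro ex_cong1 conj_cong refl)
        (simp_all only: legal[of _ Right, unfolded opponent.simps] IH[of _ Right, unfolded opponent.simps])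
    have opts: "H |\<in>| ropts (- path_snort n c) \<longleftrightarrow> (\<exists>v. legal n c Left v \<and> H = - path_snort n (c(v \<mapsto> Left)))" for H
      using lopts_path_snort[of _ n c] unfolding ropts_neg by (auto 0 3)
    show "H |\<in>| ropts (path_snort n c') \<longleftrightarrow> H |\<in>| ropts (- path_snort n c)" for H
      unfolding opts ropts_path_snort ex_reflect[of n c'] ex_legal_less[of n c]
      by (intro ex_cong1 conj_cong refl)
        (simp_all only: legal[of _ Left, unfolded opponent.simps] IH[of _ Left, unfolded opponent.simps])
  qed
qed

section \<open>Right's mirroring strategies around a central block\<close>

text \<open>The symmetry is given up on the block \<open>{a..<n - a}\<close>, where Left may be
  ahead.\<close>

definition antisym_outside :: "nat \<Rightarrow> nat \<Rightarrow> (nat \<Rightarrow> player option) \<Rightarrow> bool" where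
  "antisym_outside n a c \<longleftrightarrow> (\<forall>i<a. c (n - 1 - i) = map_option opponent (c i))"

lemma antisym_outsideD:
  assumes "antisym_outside n a c" "2 * a \<le> n" "i < n" "i \<notin> {a..<n - a}"
  shows "c (n - 1 - i) = map_option opponent (c i)"
proof (cases "i < a")
  case False
  then have "n - 1 - i < a" "n - 1 - (n - 1 - i) = i" using assms by auto
  then have "c i = map_option opponent (c (n - 1 - i))"
    using assms(1) unfolding antisym_outside_def by metis
  then show ?thesis by (simp add: option.map_comp comp_def option.map_ident)
qed (use assms(1) in \<open>simp add: antisym_outside_def\<close>)

lemma antisym_outside_upd:
  assumes "antisym_outside n a c" "2 * a \<le> n" "v \<in> {a..<n - a}"
  shows "antisym_outside n a (c(v \<mapsto> p))"
  using assms unfolding antisym_outside_def by auto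

lemma antisym_outside_upd2:
  assumes "antisym_outside n a c" "2 * a \<le> n" "v < n" "v \<noteq> n - 1 - v"
  shows "antisym_outside n a (c(v \<mapsto> p, n - 1 - v \<mapsto> opponent p))"
  using assms unfolding antisym_outside_def by auto

text \<open>A Left piece next to the mirror image and outside the block would reflect to a Right
  piece next to v. What remains to be excluded is a Left piece inside the block and adjacency of v
  to its own image.\<close>

lemma mirror_legal:
  assumes c: "antisym_outside n a c" "2 * a \<le> n"
    and v: "legal n c Left v" "v \<notin> {a..<n - a}"
    and block: "\<And>u. u < n \<Longrightarrow> n - 1 - v = Suc u \<or> u = Suc (n - 1 - v) \<Longrightarrow> u \<in> {a..<n - a} \<Longrightarrow> c u \<noteq> Some Left"
    and nonadj: "v \<noteq> Suc (n - 1 - v)" "n - 1 - v \<noteq> Suc v"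
  shows "legal n (c(v \<mapsto> Left)) Right (n - 1 - v)"
proof -
  have "v < n" "c v = None" and nb: "\<And>u. u < n \<Longrightarrow> v = Suc u \<or> u = Suc v \<Longrightarrow> c u \<noteq> Some Right"
    using v(1) by (auto simp: legal_def)
  have "c (n - 1 - v) = None"
    using antisym_outsideD[OF c \<open>v < n\<close> v(2)] \<open>c v = None\<close> by simp
  moreover have "v \<noteq> n - 1 - v" using v(2) c(2) \<open>v < n\<close> by auto
  moreover have "c u \<noteq> Some Left" if u: "u < n" "n - 1 - v = Suc u \<or> u = Suc (n - 1 - v)" for u
  proof (cases "u \<in> {a..<n - a}")
    case False
    have "v = Suc (n - 1 - u) \<or> n - 1 - u = Suc v" using u \<open>v < n\<close> by auto
    then have "c (n - 1 - u) \<noteq> Some Right" using nb[of "n - 1 - u"] u by auto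
    then show ?thesis
      using antisym_outsideD[OF c u(1) False] by auto
  qed (use block u in blast)
  ultimately show ?thesis
    using \<open>v < n\<close> nonadj unfolding legal_def by auto
qed

text \<open>Right's strategy as second player on the path minus k: he answers on the path, or spends
  one of his k free moves and leaves j = k - 1.\<close>

lemma path_snort_le_nat:
  assumes "\<And>v. legal n c Left v \<Longrightarrow>
    (\<exists>w. legal n (c(v \<mapsto> Left)) Right w \<and> path_snort n (c(v \<mapsto> Left, w \<mapsto> Right)) \<le> int_game (int k)) \<or>
    (\<exists>j. k = Suc j \<and> path_snort n (c(v \<mapsto> Left)) \<le> int_game (int j))"
  shows "path_snort n c \<le> int_game (int k)"
proof (subst game_le_iff, intro conjI allI impI)
  fix G assume "G |\<in>| lopts (path_snort n c)"
  then obtain v where v: "legal n c Left v" "G = path_snort n (c(v \<mapsto> Left))"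
    by (auto simp: lopts_path_snort)
  from assms[OF v(1)] show "\<not> int_game (int k) \<le> G"
  proof (elim disjE exE conjE)
    fix w assume w: "legal n (c(v \<mapsto> Left)) Right w" "path_snort n (c(v \<mapsto> Left, w \<mapsto> Right)) \<le> int_game (int k)"
    then have "path_snort n (c(v \<mapsto> Left, w \<mapsto> Right)) |\<in>| ropts G"
      unfolding v(2) ropts_path_snort by blast
    from not_ropt_le[OF this] show ?thesis
      using order_trans[OF w(2)] by blast
  next
    fix j assume "k = Suc j" "path_snort n (c(v \<mapsto> Left)) \<le> int_game (int j)"
    then show ?thesis
      using order_trans[of "int_game (int k)" G "int_game (int j)"] by (auto simp: v(2) int_le_iff)
  qed
qed (simp add: ropts_int)

text \<open>A Left move inside the block fills one of its vertices and so pays for the free move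
  that answers it; \<open>d\<close> is a reserve kept for later.\<close>

lemma spend_move:
  assumes "v \<in> {a..<n - a}" "c v = None" "empties c {a..<n - a} + d \<le> k"
  obtains j where "k = Suc j" "empties (c(v \<mapsto> p)) {a..<n - a} + d \<le> j"
  using empties_upd_in[of "{a..<n - a}" v c p] assms that[of "k - 1"] by simp

text \<open>Right mirrors every move outside the block, and answers a move inside it with a free move. The
  Right piece at the border of the block keeps the mirrored moves next to the block legal.\<close>

lemma path_snort_le_closed_block:
  assumes "antisym_outside n a c" "a = 0 \<or> 2 * a < n \<and> (c a = Some Right \<or> c (n - 1 - a) = Some Right)"
    and "empties c {a..<n - a} \<le> k"
  shows "path_snort n c \<le> int_game (int k)"
  using assms
proof (induction "empties c {..<n}" arbitrary: c k rule: less_induct)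
  case less
  note c = less.prems
  have a: "2 * a \<le> n" using c(2) by auto
  have step: "empties (c(v \<mapsto> Left)) {..<n} < empties c {..<n}" if "legal n c Left v" for v
    using that empties_upd_in[of "{..<n}" v c Left] by (simp add: legal_def)
  show ?case
  proof (rule path_snort_le_nat)
    fix v assume v: "legal n c Left v"
    then have "v < n" "c v = None" by (simp_all add: legal_def)
    show "(\<exists>w. legal n (c(v \<mapsto> Left)) Right w \<and> path_snort n (c(v \<mapsto> Left, w \<mapsto> Right)) \<le> int_game (int k)) \<or>
      (\<exists>j. k = Suc j \<and> path_snort n (c(v \<mapsto> Left)) \<le> int_game (int j))"
    proof (cases "v \<in> {a..<n - a}")
      case True
      obtain j where j: "k = Suc j" "empties (c(v \<mapsto> Left)) {a..<n - a} \<le> j"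
        using spend_move[of v a n c 0 k Left] True \<open>c v = None\<close> c(3) by auto
      have "c u = Some Right \<Longrightarrow> (c(v \<mapsto> Left)) u = Some Right" for u
        using \<open>c v = None\<close> by auto
      with c(2) have border: "a = 0 \<or> 2 * a < n \<and>
          ((c(v \<mapsto> Left)) a = Some Right \<or> (c(v \<mapsto> Left)) (n - 1 - a) = Some Right)"
        by blast
      have "path_snort n (c(v \<mapsto> Left)) \<le> int_game (int j)"
        by (rule less.hyps[OF step[OF v] antisym_outside_upd[OF c(1) a True] border j(2)])
      with j show ?thesis by blast
    next
      case False
      then have "a \<noteq> 0" using \<open>v < n\<close> by auto
      with c(2) have a': "2 * a < n" and border: "c a = Some Right \<or> c (n - 1 - a) = Some Right" by auto
      have w: "legal n (c(v \<mapsto> Left)) Right (n - 1 - v)"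
      proof (rule mirror_legal[OF c(1) a v False])
        fix u assume u: "u < n" "n - 1 - v = Suc u \<or> u = Suc (n - 1 - v)" "u \<in> {a..<n - a}"
        then have "v = a - 1 \<and> u = n - 1 - a \<or> v = n - a \<and> u = a"
          using False \<open>v < n\<close> a' by auto
        then consider "v = a - 1" "u = n - 1 - a" | "v = n - a" "u = a" by blast
        \<comment> \<open>The Right piece cannot be at the end of the block next to v, where Left
          just moved legally. It is at the other end, next to the mirror image.\<close>
        then show "c u \<noteq> Some Left"
        proof cases
          case 1
          then have "c a \<noteq> Some Right" using legal_neighbour[OF v, of a] a' \<open>a \<noteq> 0\<close> by simp
          with border 1 show ?thesis by simp
        next
          case 2
          moreover have "n - a = Suc (n - 1 - a)" using a' by auto
          ultimately have "c (n - 1 - a) \<noteq> Some Right"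
            using legal_neighbour[OF v, of "n - 1 - a"] a' by simp
          with border 2 show ?thesis by simp
        qed
      qed (use False a' \<open>v < n\<close> in auto)
      have notin: "n - 1 - v \<notin> {a..<n - a}" "v \<noteq> n - 1 - v" using False \<open>v < n\<close> a' by auto
      have "path_snort n (c(v \<mapsto> Left, n - 1 - v \<mapsto> Right)) \<le> int_game (int k)"
      proof (rule less.hyps)
        show "empties (c(v \<mapsto> Left, n - 1 - v \<mapsto> Right)) {..<n} < empties c {..<n}"
          using step[OF v] empties_upd_in[of "{..<n}" "n - 1 - v" "c(v \<mapsto> Left)" Right] w
          by (simp add: legal_def)
        show "antisym_outside n a (c(v \<mapsto> Left, n - 1 - v \<mapsto> Right))"
          using antisym_outside_upd2[OF c(1) a \<open>v < n\<close> notin(2), of Left] by simp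
        show "a = 0 \<or> 2 * a < n \<and> ((c(v \<mapsto> Left, n - 1 - v \<mapsto> Right)) a = Some Right \<or>
            (c(v \<mapsto> Left, n - 1 - v \<mapsto> Right)) (n - 1 - a) = Some Right)"
        proof -
          have "a \<noteq> v" "n - 1 - a \<noteq> v" using False a' by auto
          moreover have "a \<noteq> n - 1 - v" "n - 1 - a \<noteq> n - 1 - v" using notin False a' \<open>v < n\<close> by auto
          ultimately show ?thesis using a' border by simp
        qed
        show "empties (c(v \<mapsto> Left, n - 1 - v \<mapsto> Right)) {a..<n - a} \<le> k"
          using c(3) False notin(1) by (simp add: empties_upd_notin)
      qed
      with w show ?thesis by blast
    qed
  qed
qed

text \<open>Once Left plays next to the block where the mirrored move is illegal, Right closes the block
  within three further pairs of vertices; this costs at most six free moves.\<close>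

lemma path_snort_le_attacked_block:
  assumes c: "antisym_outside n a c" "2 * a \<le> n" "0 < a" and v: "legal n c Left (a - 1)"
    and k: "empties c {a..<n - a} + 6 \<le> k"
  shows "(\<exists>w. legal n (c(a - 1 \<mapsto> Left)) Right w \<and> path_snort n (c(a - 1 \<mapsto> Left, w \<mapsto> Right)) \<le> int_game (int k)) \<or>
      (\<exists>j. k = Suc j \<and> path_snort n (c(a - 1 \<mapsto> Left)) \<le> int_game (int j))"
proof -
  let ?c = "c(a - 1 \<mapsto> Left)"
  obtain j where j: "k = Suc j" using k by (cases k) auto
  have mirror: "c (n - 1 - i) = map_option opponent (c i)" if "i < a" for i
    using c(1) that by (simp add: antisym_outside_def)
  have va: "c (a - 1) = None" "a - 1 < n" using v by (simp_all add: legal_def)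
  have outside: "antisym_outside n b ?c" if "b < a" for b
    using c(1,2) that unfolding antisym_outside_def by auto
  \<comment> \<open>Widening adds a - b vertices on each side, one of which Left has just
    taken.\<close>
  have grow: "empties ?c {b..<n - b} \<le> empties c {a..<n - a} + (2 * (a - b) - 1)" if "b < a" for b
  proof -
    have "{i \<in> {b..<n - b}. ?c i = None} \<subseteq> {i \<in> {a..<n - a}. c i = None} \<union> ({b..<a - 1} \<union> {n - a..<n - b})"
      using that by auto
    then have "empties ?c {b..<n - b} \<le> card ({i \<in> {a..<n - a}. c i = None} \<union> ({b..<a - 1} \<union> {n - a..<n - b}))"
      unfolding empties_def by (rule card_mono[rotated]) simp
    also have "\<dots> \<le> empties c {a..<n - a} + (card {b..<a - 1} + card {n - a..<n - b})"
      unfolding empties_def by (meson add_left_mono card_Un_le order_trans)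
    also have "\<dots> \<le> empties c {a..<n - a} + (2 * (a - b) - 1)"
      using that c(2) by auto
    finally show ?thesis .
  qed
  \<comment> \<open>Right looks for a piece of his own at an end of a wider block. None is needed if
    the block becomes the whole path. A piece on a - 2 must be Left's, as Left may play beside it,
    so its image is Right's. A Right piece on a - 3 serves directly. Otherwise Right plays on the
    image of a - 2.\<close>
  consider "a = 1" | "a \<ge> 2" "c (a - 2) \<noteq> None" | "a \<ge> 3" "c (a - 2) = None" "c (a - 3) = Some Right"
    | "a \<ge> 2" "c (a - 2) = None" "a \<ge> 3 \<Longrightarrow> c (a - 3) \<noteq> Some Right"
    using c(3) by linarith
  then show ?thesis
  proof cases
    case 1
    have "path_snort n ?c \<le> int_game (int j)"
      by (rule path_snort_le_closed_block[of n 0]) (use outside[of 0] grow[of 0] k j 1 in auto)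
    with j show ?thesis by blast
  next
    case 2
    have "a - 1 = Suc (a - 2)" "a - 2 < n" using 2(1) va by auto
    then have "c (a - 2) \<noteq> Some Right"
      using legal_neighbour[OF v, of "a - 2"] by auto
    then have "c (a - 2) = Some Left"
      using 2(2) by (metis not_None_eq player.exhaust)
    then have "?c (n - 1 - (a - 2)) = Some Right"
      using mirror[of "a - 2"] 2 c(2) by auto
    then have "path_snort n ?c \<le> int_game (int j)"
      by (intro path_snort_le_closed_block[of n "a - 2"]) (use outside[of "a - 2"] grow[of "a - 2"] k j 2 c(2) in auto)
    with j show ?thesis by blast
  next
    case 3
    then have "?c (a - 3) = Some Right" by auto
    \<comment> \<open>The worst case and the origin of 6: five new empty vertices and one free
      move.\<close>
    then have "path_snort n ?c \<le> int_game (int j)"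
      by (intro path_snort_le_closed_block[of n "a - 3"]) (use outside[of "a - 3"] grow[of "a - 3"] k j 3 c(2) in auto)
    with j show ?thesis by blast
  next
    case 4
    let ?w = "n - 1 - (a - 2)"
    have w: "?w < n" "?w = n - a + 1" "?w \<noteq> a - 1" using 4(1) c(2) by auto
    have wNone: "c ?w = None" using mirror[of "a - 2"] 4 by simp
    \<comment> \<open>One neighbour is the image of a - 1, which is empty; the other is the image of
      a - 3, which is Left's only if a - 3 is Right's.\<close>
    have legal_w: "legal n ?c Right ?w"
      unfolding legal_def
    proof (intro conjI allI impI)
      fix u assume u: "u < n" "?w = Suc u \<or> u = Suc ?w"
      then have "u = n - 1 - (a - 1) \<or> a \<ge> 3 \<and> u = n - 1 - (a - 3)"
        unfolding w(2) using 4(1) c(2) by auto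
      then consider "u = n - 1 - (a - 1)" | "a \<ge> 3" "u = n - 1 - (a - 3)" by blast
      then show "?c u \<noteq> Some (opponent Right)"
      proof cases
        case 1
        then have "c u = None" "u \<noteq> a - 1" using mirror[of "a - 1"] va c(2,3) by auto
        then show ?thesis by simp
      next
        case 2
        then have "c u = map_option opponent (c (a - 3))" "u \<noteq> a - 1"
          using mirror[of "a - 3"] c(2) by auto
        then have "c u \<noteq> Some Left" "u \<noteq> a - 1"
          using 4(3) 2(1) by (simp_all only: map_opponent_eq_Some opponent.simps not_False_eq_True)
        then show ?thesis by simp
      qed
    qed (use w wNone in auto)
    have "path_snort n (?c(?w \<mapsto> Right)) \<le> int_game (int k)"
    proof (rule path_snort_le_closed_block[of n "a - 2"])
      show "antisym_outside n (a - 2) (?c(?w \<mapsto> Right))"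
        by (rule antisym_outside_upd[OF outside]) (use 4 c(2) in auto)
      show "a - 2 = 0 \<or> 2 * (a - 2) < n \<and> ((?c(?w \<mapsto> Right)) (a - 2) = Some Right \<or> (?c(?w \<mapsto> Right)) ?w = Some Right)"
        using 4 c(2) by auto
      have "empties (?c(?w \<mapsto> Right)) {a - 2..<n - (a - 2)} \<le> empties ?c {a - 2..<n - (a - 2)}"
        unfolding empties_def by (rule card_mono) auto
      then show "empties (?c(?w \<mapsto> Right)) {a - 2..<n - (a - 2)} \<le> k"
        using grow[of "a - 2"] 4 k by auto
    qed
    with legal_w show ?thesis by blast
  qed
qed

lemma antisym_outside_reflect:
  "antisym_outside n a c \<Longrightarrow> 2 * a \<le> n \<Longrightarrow> antisym_outside n a (\<lambda>i. c (n - 1 - i))"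
  unfolding antisym_outside_def by (auto simp: option.map_comp comp_def option.map_ident)

text \<open>With no Right piece at its ends the block can be attacked once from outside; the reserve
  of 6 is kept for that moment.\<close>

lemma path_snort_le_open_block:
  assumes "antisym_outside n a c" "2 * a \<le> n" "empties c {a..<n - a} + 6 \<le> k"
  shows "path_snort n c \<le> int_game (int k)"
  using assms(1,3)
proof (induction "empties c {..<n}" arbitrary: c k rule: less_induct)
  case less
  note c = less.prems(1) and k = less.prems(2) and a = assms(2)
  have step: "empties (c(v \<mapsto> Left)) {..<n} < empties c {..<n}" if "legal n c Left v" for v
    using that empties_upd_in[of "{..<n}" v c Left] by (simp add: legal_def)
  show ?case
  proof (rule path_snort_le_nat)
    fix v assume v: "legal n c Left v"
    then have "v < n" "c v = None" by (simp_all add: legal_def)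
    show "(\<exists>w. legal n (c(v \<mapsto> Left)) Right w \<and> path_snort n (c(v \<mapsto> Left, w \<mapsto> Right)) \<le> int_game (int k)) \<or>
      (\<exists>j. k = Suc j \<and> path_snort n (c(v \<mapsto> Left)) \<le> int_game (int j))"
    proof (cases "v \<in> {a..<n - a}")
      case True
      obtain j where j: "k = Suc j" "empties (c(v \<mapsto> Left)) {a..<n - a} + 6 \<le> j"
        using spend_move[of v a n c 6 k Left] True \<open>c v = None\<close> k by auto
      then show ?thesis
        using less.hyps[OF step[OF v] antisym_outside_upd[OF c a True] j(2)] by blast
    next
      case False
      \<comment> \<open>A mirrored move can be blocked only from inside the block or by v itself,
        hence only if v is adjacent to the block or, when the block is empty, to its own
        image.\<close>
      consider "v = a - 1" "0 < a" | "v = n - a" "0 < a" | "legal n (c(v \<mapsto> Left)) Right (n - 1 - v)"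
      proof (cases "v = a - 1 \<and> 0 < a \<or> v = n - a \<and> 0 < a")
        case inner: False
        have "legal n (c(v \<mapsto> Left)) Right (n - 1 - v)"
          by (rule mirror_legal[OF c a v False]) (use inner False \<open>v < n\<close> a in auto)
        with that(3) show ?thesis .
      qed (use that in blast)
      then show ?thesis
      proof cases
        case 1
        then show ?thesis
          using path_snort_le_attacked_block[OF c a _ _ k] v by simp
      next
        case 2
        \<comment> \<open>Read from the other end, the attack at n - a becomes an attack at a -
          1.\<close>
        define c' where "c' i = c (n - 1 - i)" for i
        have refl: "c (n - 1 - i) = c' i" for i by (simp add: c'_def)
        have v': "v = n - 1 - (a - 1)" "n - 1 - v = a - 1" using 2 a \<open>v < n\<close> by auto
        have legal': "legal n c'' p (n - 1 - i) \<longleftrightarrow> legal n c' p i"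
          if "\<And>i. i < n \<Longrightarrow> c'' (n - 1 - i) = c' i" "i < n" for c'' c' p i
          using legal_reflect[of n c'' id c' i p] that by (simp add: option.map_id)
        have e: "empties c' {a..<n - a} = empties c {a..<n - a}"
          unfolding empties_def
          by (rule bij_betw_same_card[of "\<lambda>i. n - 1 - i"], rule bij_betw_byWitness[where f' = "\<lambda>i. n - 1 - i"])
            (auto simp: c'_def)
        have upd: "(c(v \<mapsto> Left)) (n - 1 - i) = (c'(a - 1 \<mapsto> Left)) i" if "i < n" for i
          using that v' a \<open>v < n\<close> 2 by (auto simp: c'_def)
        have "antisym_outside n a c'" unfolding c'_def by (rule antisym_outside_reflect[OF c a])
        moreover have "legal n c' Left (a - 1)"
          using legal'[of c c' "a - 1" Left] refl v v' \<open>v < n\<close> a 2 by simp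
        ultimately have "(\<exists>w. legal n (c'(a - 1 \<mapsto> Left)) Right w \<and> path_snort n (c'(a - 1 \<mapsto> Left, w \<mapsto> Right)) \<le> int_game (int k)) \<or>
          (\<exists>j. k = Suc j \<and> path_snort n (c'(a - 1 \<mapsto> Left)) \<le> int_game (int j))"
          using 2 a k by (intro path_snort_le_attacked_block) (simp_all add: e)
        then show ?thesis
        proof (elim disjE exE conjE)
          fix w assume w: "legal n (c'(a - 1 \<mapsto> Left)) Right w"
            "path_snort n (c'(a - 1 \<mapsto> Left, w \<mapsto> Right)) \<le> int_game (int k)"
          then have "w < n" by (simp add: legal_def)
          have "legal n (c(v \<mapsto> Left)) Right (n - 1 - w)"
            using legal'[of "c(v \<mapsto> Left)" "c'(a - 1 \<mapsto> Left)" w Right] upd w(1) \<open>w < n\<close> by blast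
          moreover have "path_snort n (c(v \<mapsto> Left, n - 1 - w \<mapsto> Right)) = path_snort n (c'(a - 1 \<mapsto> Left, w \<mapsto> Right))"
            using reflect_upd[of n "c(v \<mapsto> Left)" id "c'(a - 1 \<mapsto> Left)" w _ Right] upd \<open>w < n\<close>
            by (intro path_snort_reflect) (simp only: option.map_id id_apply)
          ultimately show ?thesis using w(2) by auto
        next
          fix j assume "k = Suc j" "path_snort n (c'(a - 1 \<mapsto> Left)) \<le> int_game (int j)"
          moreover have "path_snort n (c(v \<mapsto> Left)) = path_snort n (c'(a - 1 \<mapsto> Left))"
            using upd by (rule path_snort_reflect)
          ultimately show ?thesis by auto
        qed
      next
        case 3
        have notin: "n - 1 - v \<notin> {a..<n - a}" "v \<noteq> n - 1 - v" using False \<open>v < n\<close> a by auto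
        have "path_snort n (c(v \<mapsto> Left, n - 1 - v \<mapsto> Right)) \<le> int_game (int k)"
        proof (rule less.hyps)
          show "empties (c(v \<mapsto> Left, n - 1 - v \<mapsto> Right)) {..<n} < empties c {..<n}"
            using step[OF v] empties_upd_in[of "{..<n}" "n - 1 - v" "c(v \<mapsto> Left)" Right] 3
            by (simp add: legal_def)
          show "antisym_outside n a (c(v \<mapsto> Left, n - 1 - v \<mapsto> Right))"
            using antisym_outside_upd2[OF c a \<open>v < n\<close> notin(2), of Left] by simp
          show "empties (c(v \<mapsto> Left, n - 1 - v \<mapsto> Right)) {a..<n - a} + 6 \<le> k"
            using k False notin(1) by (simp add: empties_upd_notin)
        qed
        with 3 show ?thesis by blast
      qed
    qed
  qed
qed

lemma path_snort_symmetric_reply: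
  assumes c: "\<And>i. i < n \<Longrightarrow> c (n - 1 - i) = map_option opponent (c i)"
    and G': "G' |\<in>| lopts (path_snort n c)"
  shows "G' \<le> int_game 7 \<or>
    (\<exists>d. (\<forall>i<n. d (n - 1 - i) = map_option opponent (d i)) \<and> path_snort n d |\<in>| ropts G')"
proof -
  obtain v where v: "legal n c Left v" and G'_eq: "G' = path_snort n (c(v \<mapsto> Left))"
    using G' by (auto simp: lopts_path_snort)
  then have vn: "v < n" by (simp add: legal_def)
  have anti: "antisym_outside n b c" if "2 * b \<le> n" for b
    unfolding antisym_outside_def
  proof (intro allI impI)
    fix i assume "i < b"
    with that show "c (n - 1 - i) = map_option opponent (c i)" by (intro c) simp
  qed
  let ?w = "n - 1 - v"
  show ?thesis
  proof (cases "?w \<noteq> v \<and> legal n (c(v \<mapsto> Left)) Right ?w")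
    case True
    have "(c(v \<mapsto> Left, ?w \<mapsto> Right)) (n - 1 - i) = map_option opponent ((c(v \<mapsto> Left, ?w \<mapsto> Right)) i)"
      if i: "i < n" for i
    proof -
      have "n - 1 - i = v \<longleftrightarrow> i = ?w" "n - 1 - i = ?w \<longleftrightarrow> i = v" using i vn by auto
      then show ?thesis using c[OF i] True by simp
    qed
    moreover have "path_snort n (c(v \<mapsto> Left, ?w \<mapsto> Right)) |\<in>| ropts G'"
      unfolding G'_eq ropts_path_snort using True by blast
    ultimately show ?thesis by blast
  next
    case False
    have central: "?w = v \<or> ?w = Suc v \<or> v = Suc ?w"
    proof (rule ccontr)
      assume *: "\<not> ?thesis"
      have "legal n (c(v \<mapsto> Left)) Right ?w"
      proof (rule mirror_legal[of n "n div 2"])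
        fix u assume u: "u < n" "u \<in> {n div 2..<n - n div 2}"
        \<comment> \<open>This block is at most the middle vertex, which is its own image and
          therefore empty in an antisymmetric position.\<close>
        then have "n - 1 - u = u" by auto
        then have "map_option opponent (c u) = c u" using c[OF u(1)] by (simp only:)
        then show "c u \<noteq> Some Left" by auto
      next
        show "antisym_outside n (n div 2) c" by (rule anti) simp
        show "v \<notin> {n div 2..<n - n div 2}" using * by auto
      qed (use * v in simp_all)
      with False * show False by simp
    qed
    \<comment> \<open>The block consists of v and its image, which coincide or are adjacent. Left
      occupies v, so at most one vertex is empty, and 1 + 6 = 7.\<close>
    define a where "a = min v ?w"
    have a: "2 * a \<le> n" "a \<le> v" "v < n - a" using vn unfolding a_def by auto
    have "antisym_outside n a c"
      using a by (intro anti)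
    then have "antisym_outside n a (c(v \<mapsto> Left))"
      using a by (intro antisym_outside_upd) auto
    moreover have "{i \<in> {a..<n - a}. (c(v \<mapsto> Left)) i = None} \<subseteq> {?w}"
      using central vn unfolding a_def by auto
    then have "empties (c(v \<mapsto> Left)) {a..<n - a} \<le> card {?w}"
      unfolding empties_def by (rule card_mono[rotated]) simp
    ultimately have "path_snort n (c(v \<mapsto> Left)) \<le> int_game (int 7)"
      using a(1) by (intro path_snort_le_open_block) auto
    then show ?thesis unfolding G'_eq by simp
  qed
qed

theorem theorem5p1:
  fixes n :: nat
  assumes "n \<ge> 1"
  shows "temperature (snort_empty_path n) \<le> 15 / 2"
proof -
  let ?S = "{path_snort n c |c. \<forall>i<n. c (n - 1 - i) = map_option opponent (c i)}"
  have start: "snort_empty_path n \<in> ?S"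
    unfolding snort_empty_path_def mem_Collect_eq
    by (rule exI[of _ Map.empty], rule conjI[OF refl]) simp
  have neg: "- G = G" if S: "G \<in> ?S" for G
  proof -
    obtain c where c: "\<forall>i<n. c (n - 1 - i) = map_option opponent (c i)" and G: "G = path_snort n c"
      using S by blast
    show ?thesis
      unfolding G by (rule path_snort_reflect_neg[symmetric]) (rule c[rule_format])
  qed
  have reply: "G' \<le> int_game 7 \<or> (\<exists>H\<in>?S. H |\<in>| ropts G')" if S: "G \<in> ?S" and G': "G' |\<in>| lopts G" for G G'
  proof -
    obtain c where c: "\<forall>i<n. c (n - 1 - i) = map_option opponent (c i)" and G: "G = path_snort n c"
      using S by blast
    have "G' |\<in>| lopts (path_snort n c)" using G' G by simp
    then have "G' \<le> int_game 7 \<or>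
        (\<exists>d. (\<forall>i<n. d (n - 1 - i) = map_option opponent (d i)) \<and> path_snort n d |\<in>| ropts G')"
      by (rule path_snort_symmetric_reply[rotated]) (rule c[rule_format])
    then show ?thesis
    proof (elim disjE exE conjE)
      fix d assume "\<forall>i<n. d (n - 1 - i) = map_option opponent (d i)" and d: "path_snort n d |\<in>| ropts G'"
      then have "path_snort n d \<in> ?S" by blast
      with d show ?thesis by blast
    qed simp
  qed
  \<comment> \<open>Of the constant, only that it is dyadic and at least 7 matters.\<close>
  have "15 / 2 \<in> cooling_params"
    unfolding cooling_params_def using dyadicsI[of "15 / 2" 15 1] by simp
  from temperature_le_symmetric_strategy[OF neg reply this _ start] show ?thesis by simp
qed

end
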